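(* For every fixed integer $k\ge2$ and every $\epsilon>0$ there exist a \textsc{(1,2)-TSP} instance $I$ and an initial tour $T$ such that every possible execution of the $k$-improv algorithm started with $T$ outputs a tour of cost at least $\left(\frac{11}{10}-\epsilon\right)\mathrm{OPT}(I)$. Consequently the approximation ratio of the $k$-improv algorithm for \textsc{(1,2)-TSP} is at least $\frac{11}{10}$.
   Context: A \textsc{(1,2)-TSP} instance is a complete graph $K_n$ with edge costs in $\{1,2\}$. A tour is a Hamiltonian cycle, with cost $c(T)=\sum_{e\in T}c(e)$; $\mathrm{OPT}(I)$ is the minimum tour cost. A 2-matching is an edge set in which every vertex has degree at most $2$, i.e. a vertex-disjoint union of paths and cycles; a singleton is a vertex of degree $0$ in it, and connected components include singletons. A $k$-improv-move deletes and adds in total at most $k$ edges of a 2-matching $M$ to obtain a new 2-matching $M'$ (the numbers of deleted and added edges need not be equal). It is improving if $M'$ consists only of cost-1 edges and either $M'$ has fewer connected components than $M$, or the same number of components but more cycles, or the same numbers of components and cycles but fewer singletons. The $k$-improv algorithm: start with a tour $T$; let $M$ be $T$ with all cost-2 edges removed; while an improving $k$-improv-move for $M$ exists, perform one; then delete an arbitrary edge from each cycle of $M$ and join the resulting paths arbitrarily into a tour, which is output. *)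

theory Defs
  imports Complex_Main
begin

definition vertices :: "nat \<Rightarrow> nat set" where
  "vertices n = {0..<n}"

definition kn_edges :: "nat \<Rightarrow> nat set set" where
  "kn_edges n = {e. e \<subseteq> vertices n \<and> card e = 2}"

definition is_12_instance :: "nat \<Rightarrow> (nat set \<Rightarrow> nat) \<Rightarrow> bool" where
  "is_12_instance n c \<longleftrightarrow> (\<forall>e \<in> kn_edges n. c e = 1 \<or> c e = 2)"

definition is_tour :: "nat \<Rightarrow> nat set set \<Rightarrow> bool" where
  "is_tour n T \<longleftrightarrow> n \<ge> 3 \<and> (\<exists>vs. distinct vs \<and> set vs = vertices n \<and>
      T = {{vs ! i, vs ! ((i + 1) mod n)} | i. i < n})"

definition tour_cost :: "(nat set \<Rightarrow> nat) \<Rightarrow> nat set set \<Rightarrow> nat" where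
  "tour_cost c T = (\<Sum>e\<in>T. c e)"

definition OPT :: "nat \<Rightarrow> (nat set \<Rightarrow> nat) \<Rightarrow> nat" where
  "OPT n c = Min {tour_cost c T | T. is_tour n T}"

definition deg :: "nat set set \<Rightarrow> nat \<Rightarrow> nat" where
  "deg M v = card {e \<in> M. v \<in> e}"

definition two_matching :: "nat \<Rightarrow> nat set set \<Rightarrow> bool" where
  "two_matching n M \<longleftrightarrow> M \<subseteq> kn_edges n \<and> (\<forall>v \<in> vertices n. deg M v \<le> 2)"

definition adj :: "nat set set \<Rightarrow> (nat \<times> nat) set" where
  "adj M = {(u, v). {u, v} \<in> M}"

definition components :: "nat \<Rightarrow> nat set set \<Rightarrow> nat set set" where
  "components n M = (\<lambda>v. {w. (v, w) \<in> (adj M)\<^sup>*}) ` vertices n"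

definition cycle_components :: "nat \<Rightarrow> nat set set \<Rightarrow> nat set set" where
  "cycle_components n M = {C \<in> components n M. \<forall>v \<in> C. deg M v = 2}"

definition num_comps :: "nat \<Rightarrow> nat set set \<Rightarrow> nat" where
  "num_comps n M = card (components n M)"

definition num_cycles :: "nat \<Rightarrow> nat set set \<Rightarrow> nat" where
  "num_cycles n M = card (cycle_components n M)"

definition num_singletons :: "nat \<Rightarrow> nat set set \<Rightarrow> nat" where
  "num_singletons n M = card {v \<in> vertices n. deg M v = 0}"

definition improving_move ::
  "nat \<Rightarrow> nat \<Rightarrow> (nat set \<Rightarrow> nat) \<Rightarrow> nat set set \<Rightarrow> nat set set \<Rightarrow> bool" where
  "improving_move k n c M M' \<longleftrightarrow>
     two_matching n M' \<and>
     card (M - M') + card (M' - M) \<le> k \<and>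
     (\<forall>e \<in> M'. c e = 1) \<and>
     (num_comps n M' < num_comps n M \<or>
      (num_comps n M' = num_comps n M \<and> num_cycles n M' > num_cycles n M) \<or>
      (num_comps n M' = num_comps n M \<and> num_cycles n M' = num_cycles n M \<and>
       num_singletons n M' < num_singletons n M))"

definition improv_step :: "nat \<Rightarrow> nat \<Rightarrow> (nat set \<Rightarrow> nat) \<Rightarrow> (nat set set \<times> nat set set) set" where
  "improv_step k n c = {(M, M'). improving_move k n c M M'}"

text \<open>Possible final tours: delete one edge from each cycle of the terminal 2-matching M
and join the resulting paths into a tour (i.e. any tour containing the remaining paths).\<close>
definition final_tour :: "nat \<Rightarrow> nat set set \<Rightarrow> nat set set \<Rightarrow> bool" where
  "final_tour n M T' \<longleftrightarrow> is_tour n T' \<and>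
     (\<exists>D. D \<subseteq> M \<and> (\<forall>e \<in> D. \<exists>C \<in> cycle_components n M. e \<subseteq> C) \<and>
          (\<forall>C \<in> cycle_components n M. \<exists>!e. e \<in> D \<and> e \<subseteq> C) \<and>
          M - D \<subseteq> T')"

definition kimprov_output ::
  "nat \<Rightarrow> nat \<Rightarrow> (nat set \<Rightarrow> nat) \<Rightarrow> nat set set \<Rightarrow> nat set set \<Rightarrow> bool" where
  "kimprov_output k n c T T' \<longleftrightarrow>
     (\<exists>M. ({e \<in> T. c e = 1}, M) \<in> (improv_step k n c)\<^sup>* \<and>
          \<not> (\<exists>M'. improving_move k n c M M') \<and>
          final_tour n M T')"

end

(*
  Build the cost-1 graph from 5-cycles ("halves"), each with one bond vertex and two port
  vertices that are not adjacent to it on the cycle. Bonds join the halves in pairs (gadgets); joins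
  connect ports. The initial 2-matching consists of one Hamiltonian path per gadget that runs through
  both halves and the bond. Traversing the halves from port to port, along the joins, gives an almost
  optimal tour.

  Let a move change at most k edges, and let F be the set of removed bonds and added joins, viewed
  as edges between halves. If the graph of halves has girth above k, then F is a forest, so card F is
  smaller than the number of halves it touches. A touched half that keeps its bond loses at least two
  edges of its 5-cycle, because neither the bond vertex nor the port can keep both cycle edges. Counting
  edges, and noting that every completed 5-cycle is a component of its own, the number of components
  strictly increases unless F is empty; if F is empty, nothing is gained either. Thus no move is
  improving, and the output costs 11 per gadget against about 10 per gadget for the optimum.

  Large girth is obtained from a lift of a ladder: bonds in column i act on the rows by an
  involution, and short reduced products of the involutions of different columns have no fixed points.
*)
theory Submission
  imports Defs "HOL-Combinatorics.Permutations"
begin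

subsection \<open>Components of two-matchings and tours\<close>

lemma sym_adj: "sym (adj E)"
  by (auto simp: sym_def adj_def insert_commute)

lemma adj_rtrancl_sym: "(x, y) \<in> (adj E)\<^sup>* \<Longrightarrow> (y, x) \<in> (adj E)\<^sup>*"
  using sym_rtrancl[OF sym_adj] by (auto simp: sym_def)

lemma rtrancl_adj_insert:
  assumes "(x, y) \<in> (adj (insert {u, v} E))\<^sup>*"
  shows "(x, y) \<in> (adj E)\<^sup>* \<or>
    ((x, u) \<in> (adj E)\<^sup>* \<or> (x, v) \<in> (adj E)\<^sup>*) \<and> ((u, y) \<in> (adj E)\<^sup>* \<or> (v, y) \<in> (adj E)\<^sup>*)"
  using assms
proof (induction rule: rtrancl_induct)
  case base
  then show ?case by simp
next
  case (step y z)
  have "(y, z) \<in> adj E \<or> y = u \<and> z = v \<or> y = v \<and> z = u"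
    using step.hyps(2) by (auto simp: adj_def doubleton_eq_iff)
  then show ?case
    using step.IH by (blast intro: rtrancl_into_rtrancl)
qed

text \<open>The map \<open>f\<close> sends an old component to the new one containing it. A new edge
  can merge only the classes of its two ends, so \<open>f\<close> is injective once the class of
  \<open>u\<close> is set aside.\<close>

lemma num_comps_insert:
  "num_comps n E \<le> Suc (num_comps n (insert {u, v} E))"
proof -
  define K where "K = (\<lambda>w. {z. (w, z) \<in> (adj E)\<^sup>*})"
  define K' where "K' = (\<lambda>w. {z. (w, z) \<in> (adj (insert {u, v} E))\<^sup>*})"
  define f where "f C = \<Union> (K' ` C)" for C
  have mono: "(adj E)\<^sup>* \<subseteq> (adj (insert {u, v} E))\<^sup>*"
    by (rule rtrancl_mono) (auto simp: adj_def)
  have fK: "f (K w) = K' w" for w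
    using mono by (auto simp: f_def K_def K'_def intro: rtrancl_trans)
  have K_eq: "K x = K y" if "(x, y) \<in> (adj E)\<^sup>*" for x y
    using that adj_rtrancl_sym[OF that] by (auto simp: K_def intro: rtrancl_trans)
  have inj: "inj_on f (components n E - {K u})"
  proof (rule inj_onI)
    fix C D assume C: "C \<in> components n E - {K u}" and D: "D \<in> components n E - {K u}" and eq: "f C = f D"
    obtain x y where x: "C = K x" and y: "D = K y"
      using C D by (auto simp: components_def K_def)
    have "K' x = K' y" using eq x y fK by simp
    then have "(x, y) \<in> (adj (insert {u, v} E))\<^sup>*" by (auto simp: K'_def)
    from rtrancl_adj_insert[OF this] show "C = D"
    proof
      assume "(x, y) \<in> (adj E)\<^sup>*"
      then show ?thesis using K_eq x y by simp
    next
      assume *: "((x, u) \<in> (adj E)\<^sup>* \<or> (x, v) \<in> (adj E)\<^sup>*) \<and> ((u, y) \<in> (adj E)\<^sup>* \<or> (v, y) \<in> (adj E)\<^sup>*)"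
      have "(x, v) \<in> (adj E)\<^sup>*" "(v, y) \<in> (adj E)\<^sup>*"
        using * C D x y K_eq by auto
      then show ?thesis using K_eq x y by simp
    qed
  qed
  have sub: "f ` (components n E - {K u}) \<subseteq> components n (insert {u, v} E)"
    using fK by (auto simp: components_def K_def K'_def)
  have fin: "finite (components n E')" for E'
    by (simp add: components_def vertices_def)
  have "card (components n E - {K u}) \<le> card (components n (insert {u, v} E))"
    using card_inj_on_le[OF inj sub fin] .
  then show ?thesis
    using card_Diff1_le[of "components n E" "K u"] fin[of E]
    by (cases "K u \<in> components n E") (auto simp: num_comps_def)
qed

text \<open>Induction from \<open>n\<close> isolated vertices: every edge lowers the number of
  components by at most one.\<close>

lemma num_comps_lower:
  assumes "finite E" "E \<subseteq> kn_edges n"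
  shows "n \<le> num_comps n E + card E"
  using assms
proof (induction E rule: finite_induct)
  case empty
  have "adj {} = {}" by (auto simp: adj_def)
  then have "components n {} = (\<lambda>v. {v}) ` {0..<n}" by (simp add: components_def vertices_def)
  then show ?case by (simp add: num_comps_def card_image)
next
  case (insert e E)
  obtain u v where "e = {u, v}"
    using insert.prems by (auto simp: kn_edges_def card_2_iff)
  then show ?case using insert num_comps_insert[of n E u v] by auto
qed

text \<open>Used in \<open>components_lower\<close> to discard edges whose ends stay connected
  without them.\<close>

lemma num_comps_cong:
  assumes "E' \<subseteq> E" "adj E \<subseteq> (adj E')\<^sup>*"
  shows "num_comps n E = num_comps n E'"
proof -
  have "(adj E)\<^sup>* = (adj E')\<^sup>*"
    using assms by (intro rtrancl_subset) (auto simp: adj_def)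
  then show ?thesis by (simp add: num_comps_def components_def)
qed

section \<open>Two-matchings, tours and bounds on the optimum\<close>

lemma finite_kn_edges: "finite (kn_edges n)"
  by (rule finite_subset[of _ "Pow {0..<n}"]) (auto simp: kn_edges_def vertices_def)

lemma two_matching_finite: "two_matching n M \<Longrightarrow> finite M"
  using finite_kn_edges finite_subset by (auto simp: two_matching_def)

lemma deg_three:
  assumes "finite M" "deg M v \<le> 2" "e1 \<in> M" "e2 \<in> M" "e3 \<in> M"
    and "v \<in> e1" "v \<in> e2" "v \<in> e3" "e1 \<noteq> e2" "e1 \<noteq> e3" "e2 \<noteq> e3"
  shows False
proof -
  have "card {e1, e2, e3} \<le> card {e \<in> M. v \<in> e}"
    using assms by (intro card_mono) auto
  then show False using assms by (simp add: deg_def)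
qed

lemma mod_Suc_eq: "i < n \<Longrightarrow> Suc i mod n = (if Suc i = n then 0 else Suc i)" for i n :: nat
  by auto

lemma tour_props:
  assumes "is_tour n T"
  shows "finite T" "card T = n" "T \<subseteq> kn_edges n" "deg T v \<le> 2"
proof -
  obtain vs where n: "n \<ge> 3" and vs: "distinct vs" "set vs = vertices n"
    and T: "T = {{vs ! i, vs ! ((i + 1) mod n)} | i. i < n}"
    using assms by (auto simp: is_tour_def)
  have len: "length vs = n"
    using distinct_card[OF vs(1)] vs(2) by (simp add: vertices_def)
  define f where "f i = {vs ! i, vs ! ((i + 1) mod n)}" for i
  have Tf: "T = f ` {..<n}" by (auto simp: T f_def)
  have nth: "vs ! i = vs ! j \<longleftrightarrow> i = j" if "i < n" "j < n" for i j
    using that vs(1) len by (simp add: nth_eq_iff_index_eq)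
  \<comment> \<open>Distinct positions with the same edge would each be the cyclic successor of the
    other, which \<open>n \<ge> 3\<close> rules out.\<close>
  have inj: "inj_on f {..<n}"
  proof (rule inj_onI)
    fix i j assume i: "i \<in> {..<n}" and j: "j \<in> {..<n}" and "f i = f j"
    then show "i = j"
      using n by (auto simp: f_def doubleton_eq_iff nth mod_Suc_eq split: if_splits)
  qed
  show "finite T" by (simp add: Tf)
  show "card T = n" by (simp add: Tf card_image[OF inj])
  show "T \<subseteq> kn_edges n"
  proof
    fix e assume "e \<in> T"
    then obtain i where i: "i < n" and e: "e = f i" by (auto simp: Tf)
    have "vs ! i \<noteq> vs ! ((i + 1) mod n)" using i n by (auto simp: nth mod_Suc_eq)
    moreover have "vs ! i \<in> vertices n" "vs ! ((i + 1) mod n) \<in> vertices n"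
      using i n len unfolding vs(2)[symmetric] by (auto intro!: nth_mem)
    ultimately show "e \<in> kn_edges n" by (auto simp: e f_def kn_edges_def)
  qed
  show "deg T v \<le> 2"
  proof (cases "v \<in> set vs")
    case True
    then obtain p where p: "p < n" "vs ! p = v" using len by (auto simp: in_set_conv_nth)
    define p' where "p' = (if p = 0 then n - 1 else p - 1)"
    have "{e \<in> T. v \<in> e} \<subseteq> f ` {p, p'}"
    proof
      fix e assume "e \<in> {e \<in> T. v \<in> e}"
      then obtain i where i: "i < n" "e = f i" and "v \<in> f i" by (auto simp: Tf)
      then have "i = p \<or> (i + 1) mod n = p" using p n by (auto simp: f_def nth)
      then have "i = p \<or> i = p'" using i p by (auto simp: p'_def mod_Suc_eq split: if_splits)
      then show "e \<in> f ` {p, p'}" using i by auto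
    qed
    then have "deg T v \<le> card (f ` {p, p'})" unfolding deg_def by (intro card_mono) auto
    also have "\<dots> \<le> card {p, p'}" by (rule card_image_le) simp
    also have "\<dots> \<le> 2" by (simp add: card_insert_if)
    finally show ?thesis .
  next
    case False
    then have "{e \<in> T. v \<in> e} = {}"
      using \<open>T \<subseteq> kn_edges n\<close> vs(2) by (auto simp: kn_edges_def)
    then have "deg T v = 0" by (simp only: deg_def card.empty)
    then show ?thesis by simp
  qed
qed

lemma is_tour_reindex:
  assumes "n \<ge> 3" "bij_betw w {..<n} {..<n}"
  shows "is_tour n {{w i, w ((i + 1) mod n)} | i. i < n}"
  unfolding is_tour_def
proof (intro conjI exI)
  show "distinct (map w [0..<n])" "set (map w [0..<n]) = vertices n"
    using assms(2) by (auto simp: distinct_map bij_betw_def vertices_def atLeast0LessThan)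
  show "{{w i, w ((i + 1) mod n)} | i. i < n} =
      {{map w [0..<n] ! i, map w [0..<n] ! ((i + 1) mod n)} | i. i < n}"
    by (intro Collect_cong ex_cong1) (use assms(1) in auto)
qed fact

lemma OPT_le: "is_tour n T \<Longrightarrow> OPT n c \<le> tour_cost c T"
proof -
  assume "is_tour n T"
  moreover have "{T. is_tour n T} \<subseteq> Pow (kn_edges n)" using tour_props(3) by auto
  then have "finite {T. is_tour n T}" using finite_kn_edges finite_subset[of _ "Pow (kn_edges n)"] by auto
  then have "finite {tour_cost c T | T. is_tour n T}" by auto
  ultimately show ?thesis unfolding OPT_def by (intro Min_le) auto
qed

text \<open>Each step of the tour costs one, plus one more if its edge is expensive, so bounding the
  optimum reduces to counting expensive steps.\<close>

lemma OPT_reindex_le: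
  assumes n: "n \<ge> 3" and w: "bij_betw w {..<n} {..<n}" and c: "\<And>e. c e \<le> 2"
  shows "OPT n c \<le> n + card {t \<in> {..<n}. c {w t, w ((t + 1) mod n)} \<noteq> 1}"
proof -
  define f where "f t = {w t, w ((t + 1) mod n)}" for t
  have T: "is_tour n (f ` {..<n})"
    using is_tour_reindex[OF n w] by (simp add: f_def image_def lessThan_def Bex_def conj_commute)
  have "tour_cost c (f ` {..<n}) \<le> (\<Sum>t<n. c (f t))"
    unfolding tour_cost_def using sum_image_le[of "{..<n}" c f] by simp
  also have "\<dots> \<le> (\<Sum>t<n. 1 + of_bool (c (f t) \<noteq> 1))"
  proof (rule sum_mono)
    fix t show "c (f t) \<le> 1 + of_bool (c (f t) \<noteq> 1)" using c[of "f t"] by simp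
  qed
  also have "\<dots> = n + card {t \<in> {..<n}. c (f t) \<noteq> 1}"
    by (simp only: sum.distrib) (simp add: of_bool_def sum.If_cases Int_def)
  finally show ?thesis using OPT_le[OF T, of c] by (simp add: f_def)
qed

subsection \<open>Local optimality of the gadget paths\<close>

definition half_cycle :: "nat \<Rightarrow> nat set set" where
  "half_cycle h = {{5*h, 5*h+1}, {5*h+1, 5*h+2}, {5*h+2, 5*h+3}, {5*h+3, 5*h+4}, {5*h, 5*h+4}}"

text \<open>Gadget \<open>g\<close> consists of the halves \<open>2*g\<close> and
  \<open>2*g+1\<close>, so \<open>div 5\<close> yields the half of a vertex and
  \<open>div 10\<close> its gadget.\<close>

definition bond :: "nat \<Rightarrow> nat set" where
  "bond g = {10*g+4, 10*g+5}"

definition bonds :: "nat \<Rightarrow> nat set set" where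
  "bonds B = bond ` {..<B}"

text \<open>The gadget paths: in gadget \<open>g\<close> the Hamiltonian path visits \<open>10 * g, \<dots>, 10 * g + 9\<close> in
  this order, so that the initial tour can be the identity.\<close>

definition paths :: "nat \<Rightarrow> nat set set" where
  "paths B = {{v, v + 1} | v. v < 10*B \<and> v mod 10 \<noteq> 9}"

lemma Suc_less_if_not_last:
  assumes "v < 10*B" "v mod 10 \<noteq> 9" shows "v + 1 < 10*(B::nat)"
proof (rule ccontr)
  assume "\<not> v + 1 < 10*B"
  then have "Suc v mod 10 = 0" using assms(1) by (metis Suc_eq_plus1 Suc_leI le_neq_implies_less mod_mult_self1_is_0)
  then show False using assms(2) by (simp add: mod_Suc split: if_splits)
qed

definition cheap :: "nat \<Rightarrow> nat set set \<Rightarrow> nat set set" where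
  "cheap B J = (\<Union>h<2*B. half_cycle h) \<union> bonds B \<union> J"

text \<open>The residues in \<open>join_ports\<close> are those of the vertices not adjacent to the
  bond vertex on their 5-cycle: bond vertices have residue 4 in even halves and 5 in odd ones.
  \<open>girth\<close> is the form in which acyclicity of few connecting edges enters the
  counting.\<close>

locale gadgets =
  fixes B k :: nat and J :: "nat set set"
  assumes B_pos: "B > 0"
    and join_ports: "e \<in> J \<Longrightarrow> \<exists>u v. e = {u, v} \<and> u div 5 \<noteq> v div 5 \<and> u < 10*B \<and> v < 10*B \<and>
          u mod 10 \<in> {1, 2, 7, 8} \<and> v mod 10 \<in> {1, 2, 7, 8}"
    and girth: "\<lbrakk>F \<subseteq> J \<union> bonds B; F \<noteq> {}; card F \<le> k\<rbrakk> \<Longrightarrow> card F < card ((\<lambda>v. v div 5) ` \<Union>F)"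
begin

lemma half_cycle_div: "e \<in> half_cycle h \<Longrightarrow> v \<in> e \<Longrightarrow> v div 5 = h"
  by (auto simp: half_cycle_def)

lemma join_not_half: "e \<in> J \<Longrightarrow> e \<notin> half_cycle h"
proof
  assume e: "e \<in> J" "e \<in> half_cycle h"
  obtain u v where "e = {u, v}" "u div 5 \<noteq> v div 5" using join_ports[OF e(1)] by blast
  then show False using half_cycle_div[OF e(2)] by auto
qed

lemma join_not_bond: "e \<in> J \<Longrightarrow> e \<noteq> bond g"
proof
  assume e: "e \<in> J" "e = bond g"
  obtain u v where uv: "e = {u, v}" "u mod 10 \<in> {1, 2, 7, 8}" using join_ports[OF e(1)] by blast
  have "u \<in> bond g" using e(2) uv(1) by blast
  then have "u mod 10 = 4 \<or> u mod 10 = 5" by (auto simp: bond_def)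
  then show False using uv(2) by auto
qed

lemma bond_not_half: "bond g \<notin> half_cycle h"
proof
  assume "bond g \<in> half_cycle h"
  from half_cycle_div[OF this, of "10*g+4"] half_cycle_div[OF this, of "10*g+5"] show False
    by (auto simp: bond_def)
qed

lemma paths_eq: "paths B = (\<Union>h<2*B. half_cycle h - {{5*h, 5*h+4}}) \<union> bonds B"
proof (rule set_eqI, rule iffI)
  fix e assume "e \<in> paths B"
  then obtain v where v: "e = {v, v + 1}" "v < 10*B" "v mod 10 \<noteq> 9" by (auto simp: paths_def)
  show "e \<in> (\<Union>h<2*B. half_cycle h - {{5*h, 5*h+4}}) \<union> bonds B"
  proof (cases "v mod 10 = 4")
    case True
    then have "v = 10 * (v div 10) + 4" by presburger
    then have "e = bond (v div 10)" using v(1) by (auto simp: bond_def)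
    then show ?thesis using v(2) by (auto simp: bonds_def)
  next
    case False
    define h where "h = v div 5"
    have j: "v = 5*h \<or> v = 5*h+1 \<or> v = 5*h+2 \<or> v = 5*h+3"
      using False v(3) unfolding h_def by presburger
    then have "e \<in> half_cycle h - {{5*h, 5*h+4}}"
      unfolding v(1) by (elim disjE) (simp_all add: half_cycle_def doubleton_eq_iff)
    moreover have "h < 2*B" using v(2) by (auto simp: h_def)
    ultimately show ?thesis by blast
  qed
next
  fix e assume "e \<in> (\<Union>h<2*B. half_cycle h - {{5*h, 5*h+4}}) \<union> bonds B"
  then show "e \<in> paths B"
  proof
    assume "e \<in> (\<Union>h<2*B. half_cycle h - {{5*h, 5*h+4}})"
    then obtain h where h: "h < 2*B" and "e \<in> half_cycle h" "e \<noteq> {5*h, 5*h+4}" by blast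
    have step: "{u, w} \<in> paths B" if "w = u + 1" "5*h \<le> u" "u < 5*h+4" for u w
    proof -
      have "u mod 5 = u - 5*h" using that by (intro mod_nat_eqI) auto
      then have "u mod 10 mod 5 \<noteq> 4" using that by (simp add: mod_mod_cancel)
      then have "u mod 10 \<noteq> 9" by auto
      moreover have "u < 10*B" using that h by linarith
      ultimately show ?thesis using that unfolding paths_def by blast
    qed
    have "{5*h, 5*h+1} \<in> paths B" "{5*h+1, 5*h+2} \<in> paths B" "{5*h+2, 5*h+3} \<in> paths B"
      "{5*h+3, 5*h+4} \<in> paths B"
      by (rule step; simp)+
    then show ?thesis
      using \<open>e \<in> half_cycle h\<close> \<open>e \<noteq> {5*h, 5*h+4}\<close> unfolding half_cycle_def by blast
  next
    assume "e \<in> bonds B"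
    then obtain g where g: "g < B" and e: "e = {10*g+4, 10*g+5}" by (auto simp: bonds_def bond_def)
    have "(10*g+4) mod 10 \<noteq> 9" by presburger
    moreover have "10*g+4 < 10*B" using g by simp
    ultimately show ?thesis unfolding paths_def e by (intro CollectI exI[of _ "10*g+4"]) auto
  qed
qed

lemma paths_cheap: "paths B \<subseteq> cheap B J"
  unfolding paths_eq cheap_def by blast

lemma cheap_edges: "cheap B J \<subseteq> kn_edges (10*B)"
proof
  fix e assume "e \<in> cheap B J"
  then consider h where "h < 2*B" "e \<in> half_cycle h" | g where "g < B" "e = bond g" | "e \<in> J"
    by (auto simp: cheap_def bonds_def)
  then show "e \<in> kn_edges (10*B)"
  proof cases
    case 1
    then show ?thesis by (auto simp: half_cycle_def kn_edges_def vertices_def)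
  next
    case 2
    then show ?thesis by (auto simp: bond_def kn_edges_def vertices_def)
  next
    case 3
    then obtain u v where "e = {u, v}" "u div 5 \<noteq> v div 5" "u < 10*B" "v < 10*B"
      using join_ports by blast
    then show ?thesis by (auto simp: kn_edges_def vertices_def)
  qed
qed

lemma card_paths: "card (paths B) = 9*B"
proof -
  have eq: "{v. v < 10*B \<and> v mod 10 \<noteq> 9} = {..<10*B} - (\<lambda>g. 10*g+9) ` {..<B}"
  proof -
    have "v \<in> (\<lambda>g. 10*g+9) ` {..<B}" if "v < 10*B" "v mod 10 = 9" for v
      proof (rule image_eqI[of _ _ "v div 10"])
      show "v = 10 * (v div 10) + 9" using that mult_div_mod_eq[of 10 v] by simp
    qed (use that in auto)
    moreover have "(10*g+9) mod 10 = 9" for g :: nat by presburger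
    ultimately show ?thesis by auto
  qed
  have "card {v. v < 10*B \<and> v mod 10 \<noteq> 9} = 9*B"
    unfolding eq by (subst card_Diff_subset) (auto simp: card_image inj_on_def)
  moreover have "paths B = (\<lambda>v. {v, v+1}) ` {v. v < 10*B \<and> v mod 10 \<noteq> 9}"
    by (auto simp: paths_def)
  moreover have "inj_on (\<lambda>v. {v, v+1}) {v. v < 10*B \<and> v mod 10 \<noteq> 9}"
    by (auto simp: inj_on_def doubleton_eq_iff)
  ultimately show ?thesis by (simp add: card_image)
qed

lemma paths_connected:
  assumes "v < 10*B" shows "(10 * (v div 10), v) \<in> (adj (paths B))\<^sup>*"
proof -
  have "(10 * (v div 10), 10 * (v div 10) + j) \<in> (adj (paths B))\<^sup>*" if "j < 10" for j
    using that
  proof (induction j)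
    case (Suc j)
    let ?u = "10 * (v div 10) + j"
    have "v div 10 < B" using assms by auto
    then have "?u mod 10 \<noteq> 9" "?u < 10*B" using Suc.prems by auto
    then have "(?u, ?u + 1) \<in> adj (paths B)" by (auto simp: adj_def paths_def)
    then show ?case using Suc by (auto intro: rtrancl_into_rtrancl)
  qed simp
  from this[of "v mod 10"] show ?thesis by simp
qed

lemma num_comps_paths: "num_comps (10*B) (paths B) \<le> B"
proof -
  define K where "K = (\<lambda>v. {w. (v, w) \<in> (adj (paths B))\<^sup>*})"
  have K_base: "K v = K (10 * (v div 10))" if "v < 10*B" for v
    using paths_connected[OF that] adj_rtrancl_sym[OF paths_connected[OF that]]
    by (auto simp: K_def intro: rtrancl_trans)
  have "K v \<in> (\<lambda>g. K (10*g)) ` {..<B}" if "v < 10*B" for v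
    using K_base[OF that] that by (intro image_eqI[of _ _ "v div 10"]) simp_all
  then have "components (10*B) (paths B) \<subseteq> (\<lambda>g. K (10*g)) ` {..<B}"
    unfolding components_def K_def[symmetric] by (auto simp: vertices_def)
  then have "num_comps (10*B) (paths B) \<le> card ((\<lambda>g. K (10*g)) ` {..<B})"
    unfolding num_comps_def by (intro card_mono) auto
  also have "\<dots> \<le> B" using card_image_le[of "{..<B}"] by auto
  finally show ?thesis .
qed

text \<open>Rules out the third kind of improvement, since no move can go below zero
  singletons.\<close>

lemma num_singletons_paths: "num_singletons (10*B) (paths B) = 0"
proof -
  have fin: "finite (paths B)" using card_paths B_pos by (intro card_ge_0_finite) auto
  have "deg (paths B) v \<noteq> 0" if "v < 10*B" for v
  proof -
    have "\<exists>e\<in>paths B. v \<in> e"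
    proof (cases "v mod 10 = 9")
      case True
      then have "v \<noteq> 0" "(v - 1) mod 10 \<noteq> 9" "v - 1 < 10*B"
        using that by (cases v; simp add: mod_Suc split: if_splits)+
      then have "{v - 1, (v - 1) + 1} \<in> paths B" unfolding paths_def by blast
      then show ?thesis using \<open>v \<noteq> 0\<close> by (intro bexI[of _ "{v - 1, (v - 1) + 1}"]) auto
    next
      case False
      then have "{v, v + 1} \<in> paths B" using that unfolding paths_def by blast
      then show ?thesis by blast
    qed
    then show ?thesis using fin by (auto simp: deg_def)
  qed
  then show ?thesis by (auto simp: num_singletons_def vertices_def)
qed

text \<open>Despite its name this is the bond vertex of half \<open>h\<close>, not one of the two
  vertices where joins attach.\<close>

definition port :: "nat \<Rightarrow> nat" where
  "port h = 5*h + (if even h then 4 else 0)"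

lemma bond_ports: "bond g = {port (2*g), port (2*g+1)}"
  by (auto simp: bond_def port_def)

lemma port_div: "port h div 5 = h"
  by (simp add: port_def)

lemma port_bond: "port h \<in> bond (h div 2)"
  by (cases "even h") (auto simp: bond_def port_def elim: evenE oddE)

lemma bond_div: "v \<in> bond g \<Longrightarrow> v div 5 div 2 = g"
  by (auto simp: bond_def)

section \<open>Edges that a half must lose\<close>

lemma half_cycle_card: "finite (half_cycle h)" "card (half_cycle h) = 5"
  by (auto simp: half_cycle_def doubleton_eq_iff)

text \<open>The bond uses up one of the two degrees of the bond vertex, so at most one of its two
  cycle edges survives.\<close>

lemma missing_port_edge:
  assumes M: "two_matching (10*B) M" and h: "h < 2*B" and b: "bond (h div 2) \<in> M"
  obtains e where "e \<in> half_cycle h" "port h \<in> e" "e \<notin> M"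
proof -
  \<comment> \<open>The closing edge meets the bond vertex for either parity; \<open>j\<close>
    locates the other cycle edge at it.\<close>
  define j where "j = (if even h then 3 else 0::nat)"
  have es: "{5*h, 5*h+4} \<in> half_cycle h" "{5*h+j, 5*h+j+1} \<in> half_cycle h"
    "port h \<in> {5*h, 5*h+4}" "port h \<in> {5*h+j, 5*h+j+1}" "{5*h, 5*h+4} \<noteq> {5*h+j, 5*h+j+1}"
    by (auto simp: half_cycle_def j_def port_def doubleton_eq_iff)
  have v: "deg M (port h) \<le> 2"
    using M h by (auto simp: two_matching_def vertices_def port_def)
  have "\<not> ({5*h, 5*h+4} \<in> M \<and> {5*h+j, 5*h+j+1} \<in> M)"
    using deg_three[OF two_matching_finite[OF M] v b, of "{5*h, 5*h+4}" "{5*h+j, 5*h+j+1}"]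
      es port_bond[of h] bond_not_half by metis
  then show ?thesis using es that by blast
qed

text \<open>The same degree argument at the end of a join. Since that end is not adjacent to the
  bond vertex, the missing edge avoids \<open>port\<close> and differs from the one found by
  \<open>missing_port_edge\<close>.\<close>

lemma missing_join_edge:
  assumes M: "two_matching (10*B) M" and e: "e \<in> J" "e \<in> M" and v: "v \<in> e"
  obtains e' where "e' \<in> half_cycle (v div 5)" "v \<in> e'" "port (v div 5) \<notin> e'" "e' \<notin> M"
proof -
  define h where "h = v div 5"
  have "v mod 10 \<in> {1, 2, 7, 8} \<and> v < 10*B" using join_ports[OF e(1)] v by auto
  then have v10: "v mod 10 \<in> {1, 2, 7, 8}" and vB: "v < 10*B" by auto
  have "v mod 10 = 5 * (h mod 2) + v mod 5" using mod_mult2_eq[of v 5 2] by (simp add: h_def)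
  moreover have "v = 5*h + v mod 5" "v mod 5 < 5" by (simp_all add: h_def)
  moreover have "h mod 2 = (if even h then 0 else 1)" by (simp add: odd_iff_mod_2_eq_one)
  ultimately have "even h \<and> v mod 5 \<in> {1, 2} \<or> odd h \<and> v mod 5 \<in> {2, 3}"
    using v10 by (cases "even h") auto
  then have v12: "even h \<and> (v = 5*h+1 \<or> v = 5*h+2) \<or> odd h \<and> (v = 5*h+2 \<or> v = 5*h+3)"
    using \<open>v = 5*h + v mod 5\<close> by auto
  have es: "{v - 1, v} \<in> half_cycle h \<and> {v, v+1} \<in> half_cycle h \<and> {v - 1, v} \<noteq> {v, v+1} \<and>
    port h \<notin> {v - 1, v} \<and> port h \<notin> {v, v+1}"
    using v12 by (elim disjE conjE) (simp_all add: half_cycle_def port_def doubleton_eq_iff)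
  have d: "deg M v \<le> 2" using M vB by (auto simp: two_matching_def vertices_def)
  have "\<not> ({v - 1, v} \<in> M \<and> {v, v+1} \<in> M)"
    using deg_three[OF two_matching_finite[OF M] d e(2), of "{v-1, v}" "{v, v+1}"]
      es v join_not_half[OF e(1)] by (metis insertI1 insertI2)
  then show ?thesis using es that unfolding h_def[symmetric] by (metis insertI1 insertI2)
qed

text \<open>The bond vertex and the end of the join each cost the 5-cycle an edge, and these two
  edges are different.\<close>

lemma card_half_with_join:
  assumes M: "two_matching (10*B) M" and h: "h < 2*B" and b: "bond (h div 2) \<in> M"
    and e: "e \<in> J" "e \<in> M" "v \<in> e" "v div 5 = h"
  shows "card (M \<inter> half_cycle h) \<le> 3"
proof -
  obtain e1 where e1: "e1 \<in> half_cycle h" "port h \<in> e1" "e1 \<notin> M" using missing_port_edge[OF M h b] .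
  obtain e2 where e2: "e2 \<in> half_cycle h" "port h \<notin> e2" "e2 \<notin> M"
    using missing_join_edge[OF M e(1-3)] e(4) by metis
  have "card (M \<inter> half_cycle h) \<le> card (half_cycle h - {e1, e2})"
    using e1 e2 half_cycle_card by (intro card_mono) auto
  also have "\<dots> = 3"
  proof -
    have "e1 \<noteq> e2" using e1 e2 by auto
    then show ?thesis using e1 e2 half_cycle_card by (subst card_Diff_subset) auto
  qed
  finally show ?thesis .
qed

lemma card_half:
  "card (M \<inter> half_cycle h) \<le> 4 + (if half_cycle h \<subseteq> M then 1 else 0)"
proof (cases "half_cycle h \<subseteq> M")
  case True
  then show ?thesis using half_cycle_card[of h] by (simp add: Int_absorb1)
next
  case False
  then have "card (M \<inter> half_cycle h) < card (half_cycle h)"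
    using half_cycle_card by (intro psubset_card_mono) auto
  then show ?thesis using half_cycle_card[of h] by simp
qed

text \<open>In a cycle component every vertex has degree two. Without joins, a vertex other than the
  bond vertex can reach this only through both of its 5-cycle edges; this spreads round the half
  until the bond vertex would have degree three.\<close>

lemma no_cycles:
  assumes M: "two_matching (10*B) M" "M \<subseteq> cheap B J" "M \<inter> J = {}" "bonds B \<subseteq> M"
  shows "cycle_components (10*B) M = {}"
proof (rule ccontr)
  assume "cycle_components (10*B) M \<noteq> {}"
  then obtain v where v: "v < 10*B"
    and deg: "\<And>w. (v, w) \<in> (adj M)\<^sup>* \<Longrightarrow> deg M w = 2"
    by (auto simp: cycle_components_def components_def vertices_def)
  define C where "C = {w. (v, w) \<in> (adj M)\<^sup>*}"
  define h where "h = v div 5"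
  have h: "h < 2*B" using v by (auto simp: h_def)
  have deg: "deg M w = 2" if "w \<in> C" for w using deg that by (simp add: C_def)
  have closed: "w' \<in> C" if "w \<in> C" "{w, w'} \<in> M" for w w'
    using that by (auto simp: C_def adj_def intro: rtrancl_into_rtrancl)
  have finM: "finite M" using two_matching_finite M by blast
  have inner: "e \<in> half_cycle h" if "e \<in> M" "w \<in> e" "w div 5 = h" "w \<noteq> port h" for e w
  proof -
    have "e \<in> cheap B J" "e \<notin> J" using M that by auto
    then consider h' where "e \<in> half_cycle h'" | g where "e = bond g" by (auto simp: cheap_def bonds_def)
    then show ?thesis
    proof cases
      case 1
      then show ?thesis using half_cycle_div that by blast
    next
      case 2
      then have "w = port (2*g) \<or> w = port (2*g+1)" using that bond_ports by auto
      then have "w = port h" using that(3) port_div by auto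
      then show ?thesis using that by simp
    qed
  qed
  have two: "{w, x} \<in> M \<and> {w, y} \<in> M"
    if "w \<in> C" "w div 5 = h" "w \<noteq> port h" "\<And>e. e \<in> half_cycle h \<Longrightarrow> w \<in> e \<Longrightarrow> e = {w, x} \<or> e = {w, y}" for w x y
  proof -
    have sub: "{e \<in> M. w \<in> e} \<subseteq> {{w, x}, {w, y}}" using inner that by blast
    have "\<not> {e \<in> M. w \<in> e} \<subseteq> {e'}" for e'
    proof
      assume "{e \<in> M. w \<in> e} \<subseteq> {e'}"
      then have "deg M w \<le> card {e'}" unfolding deg_def by (intro card_mono) auto
      then show False using deg[OF that(1)] by simp
    qed
    then show ?thesis using sub by blast
  qed
  have v0: "v \<in> C" by (simp add: C_def)
  have b: "bond (h div 2) \<in> M" using M(4) h by (auto simp: bonds_def)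
  obtain e where e: "e \<in> half_cycle h" "port h \<in> e" "e \<notin> M" using missing_port_edge[OF M(1) h b] .
  have vv: "v = 5*h \<or> v = 5*h+1 \<or> v = 5*h+2 \<or> v = 5*h+3 \<or> v = 5*h+4" unfolding h_def by presburger
  \<comment> \<open>The bond alone gives degree one, so a bond vertex in \<open>C\<close> has an
    edge leading into its own half.\<close>
  have at_port: "\<exists>e'. e' \<in> half_cycle h \<and> port h \<in> e' \<and> e' \<in> M" if "port h \<in> C"
  proof (rule ccontr)
    assume no: "\<nexists>e'. e' \<in> half_cycle h \<and> port h \<in> e' \<and> e' \<in> M"
    have "{e \<in> M. port h \<in> e} \<subseteq> {bond (h div 2)}"
    proof
      fix e' assume e': "e' \<in> {e \<in> M. port h \<in> e}"
      have ph: "port h div 5 = h" by (simp add: port_def)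
      have "e' \<in> cheap B J" "e' \<notin> J" using M e' by auto
      then consider h' where "e' \<in> half_cycle h'" | g where "e' = bond g" by (auto simp: cheap_def bonds_def)
      then show "e' \<in> {bond (h div 2)}"
      proof cases
        case 1
        then show ?thesis using half_cycle_div[OF 1, of "port h"] ph no e' by auto
      next
        case 2
        then show ?thesis using bond_div[of "port h" g] ph e' by auto
      qed
    qed
    then have "deg M (port h) \<le> card {bond (h div 2)}" unfolding deg_def by (intro card_mono) auto
    then show False using deg[OF that] by simp
  qed
  have step: "x \<in> C \<and> y \<in> C \<and> {w, x} \<in> M \<and> {w, y} \<in> M"
    if "w \<in> C" "w div 5 = h" "w \<noteq> port h" "\<forall>e\<in>half_cycle h. w \<in> e \<longrightarrow> e = {w, x} \<or> e = {w, y}" for w x y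
    using two[of w x y] closed[of w] that by blast
  \<comment> \<open>Going round the half, \<open>C\<close> absorbs the four other vertices and
    forces both cycle edges at the bond vertex into \<open>M\<close>, against the missing edge
    \<open>e\<close>. The parities differ only in the position of the bond vertex.\<close>
  show False
  proof (cases "even h")
    case True
    then have p: "port h = 5*h+4" by (simp add: port_def)
    have 0: "5*h+1 \<in> C \<and> {5*h, 5*h+4} \<in> M" if "5*h \<in> C"
      using step[OF that, of "5*h+1" "5*h+4"] p by (simp add: half_cycle_def doubleton_eq_iff insert_commute)
    have 1: "5*h \<in> C \<and> 5*h+2 \<in> C" if "5*h+1 \<in> C"
      using step[OF that, of "5*h" "5*h+2"] p by (simp add: half_cycle_def doubleton_eq_iff insert_commute)
    have 2: "5*h+1 \<in> C \<and> 5*h+3 \<in> C" if "5*h+2 \<in> C"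
      using step[OF that, of "5*h+1" "5*h+3"] p by (simp add: half_cycle_def doubleton_eq_iff insert_commute)
    have 3: "5*h+2 \<in> C \<and> {5*h+3, 5*h+4} \<in> M" if "5*h+3 \<in> C"
      using step[OF that, of "5*h+2" "5*h+4"] p by (simp add: half_cycle_def doubleton_eq_iff insert_commute)
    have 4: "5*h \<in> C \<or> 5*h+3 \<in> C" if "5*h+4 \<in> C"
      using at_port closed[OF that] that p by (auto simp: half_cycle_def) (metis insert_commute)+
    have "e = {5*h, 5*h+4} \<or> e = {5*h+3, 5*h+4}" using e(1,2) p by (auto simp: half_cycle_def)
    then show False using 0 1 2 3 4 vv v0 e(3) by metis
  next
    case False
    then have p: "port h = 5*h" by (simp add: port_def)
    have 1: "5*h+2 \<in> C \<and> {5*h, 5*h+1} \<in> M" if "5*h+1 \<in> C"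
      using step[OF that, of "5*h" "5*h+2"] p by (simp add: half_cycle_def doubleton_eq_iff insert_commute)
    have 2: "5*h+1 \<in> C \<and> 5*h+3 \<in> C" if "5*h+2 \<in> C"
      using step[OF that, of "5*h+1" "5*h+3"] p by (simp add: half_cycle_def doubleton_eq_iff insert_commute)
    have 3: "5*h+2 \<in> C \<and> 5*h+4 \<in> C" if "5*h+3 \<in> C"
      using step[OF that, of "5*h+2" "5*h+4"] p by (simp add: half_cycle_def doubleton_eq_iff insert_commute)
    have 4: "5*h+3 \<in> C \<and> {5*h, 5*h+4} \<in> M" if "5*h+4 \<in> C"
      using step[OF that, of "5*h" "5*h+3"] p by (simp add: half_cycle_def doubleton_eq_iff insert_commute)
    have 0: "5*h+1 \<in> C \<or> 5*h+4 \<in> C" if "5*h \<in> C"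
      using at_port closed[OF that] that p by (auto simp: half_cycle_def)
    have "e = {5*h, 5*h+1} \<or> e = {5*h, 5*h+4}" using e(1,2) p by (auto simp: half_cycle_def)
    then show False using 0 1 2 3 4 vv v0 e(3) by metis
  qed
qed

text \<open>One edge of each complete 5-cycle is redundant for connectivity. Deleting these edges
  before applying \<open>num_comps_lower\<close> gains one component per complete half.\<close>

lemma components_lower:
  assumes M: "two_matching (10*B) M"
  shows "10*B + card {h. h < 2*B \<and> half_cycle h \<subseteq> M} \<le> num_comps (10*B) M + card M"
proof -
  define Z where "Z = {h. h < 2*B \<and> half_cycle h \<subseteq> M}"
  define D where "D = (\<lambda>h. {5*h, 5*h+4}) ` Z"
  have fin: "finite M" "finite Z" using M two_matching_finite by (auto simp: Z_def)
  have card_D: "card D = card Z"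
    unfolding D_def by (intro card_image) (auto simp: inj_on_def doubleton_eq_iff)
  have D_sub: "D \<subseteq> M" by (auto simp: D_def Z_def half_cycle_def)
  have "adj M \<subseteq> (adj (M - D))\<^sup>*"
  proof clarify
    fix x y assume xy: "(x, y) \<in> adj M"
    show "(x, y) \<in> (adj (M - D))\<^sup>*"
    proof (cases "{x, y} \<in> D")
      case True
      then obtain h where h: "h \<in> Z" "{x, y} = {5*h, 5*h+4}" by (auto simp: D_def)
      have edge: "(5*h+j, 5*h+Suc j) \<in> adj (M - D)" if "j < 4" for j
      proof -
        have "j = 0 \<or> j = 1 \<or> j = 2 \<or> j = 3" using that by auto
        then have "{5*h+j, 5*h+Suc j} \<in> half_cycle h"
          unfolding half_cycle_def by (elim disjE) (simp_all add: numeral_eq_Suc)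
        moreover have "{5*h+j, 5*h+Suc j} \<notin> D" using that by (auto simp: D_def doubleton_eq_iff)
        ultimately show ?thesis using h(1) by (auto simp: adj_def Z_def)
      qed
      have "(5*h, 5*h+j) \<in> (adj (M - D))\<^sup>*" if "j \<le> 4" for j
        using that
      proof (induction j)
        case (Suc j)
        then show ?case using edge[of j] by (auto intro: rtrancl_into_rtrancl)
      qed simp
      from this[of 4] have "(5*h, 5*h+4) \<in> (adj (M - D))\<^sup>*" by simp
      then show ?thesis using h(2) adj_rtrancl_sym by (auto simp: doubleton_eq_iff)
    next
      case False
      then show ?thesis using xy by (auto simp: adj_def)
    qed
  qed
  then have "num_comps (10*B) M = num_comps (10*B) (M - D)"
    by (intro num_comps_cong) auto
  moreover have "10*B \<le> num_comps (10*B) (M - D) + card (M - D)"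
    using M fin by (intro num_comps_lower) (auto simp: two_matching_def)
  moreover have "card (M - D) + card Z = card M"
    using card_D card_mono[OF fin(1) D_sub] card_Diff_subset[of D M] D_sub fin(1)
    by (simp add: finite_subset)
  ultimately show ?thesis unfolding Z_def by linarith
qed

lemma card_two_matching:
  assumes M: "two_matching (10*B) M" "M \<subseteq> cheap B J"
  shows "card M \<le> (\<Sum>h<2*B. card (M \<inter> half_cycle h)) + card (M \<inter> bonds B) + card (M \<inter> J)"
proof -
  have "(\<Union>h<2*B. M \<inter> half_cycle h) \<union> (M \<inter> bonds B) \<union> (M \<inter> J) = M"
    using M(2) unfolding cheap_def by blast
  then have "card M \<le> card (\<Union>h<2*B. M \<inter> half_cycle h) + card (M \<inter> bonds B) + card (M \<inter> J)"
    using card_Un_le[of "(\<Union>h<2*B. M \<inter> half_cycle h) \<union> (M \<inter> bonds B)" "M \<inter> J"]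
      card_Un_le[of "\<Union>h<2*B. M \<inter> half_cycle h" "M \<inter> bonds B"] by simp
  moreover have "card (\<Union>h<2*B. M \<inter> half_cycle h) \<le> (\<Sum>h<2*B. card (M \<inter> half_cycle h))"
    by (rule card_UN_le) simp
  ultimately show ?thesis by linarith
qed

lemma card_bonds: "card (bonds B) = B"
  unfolding bonds_def by (subst card_image) (auto simp: inj_on_def bond_def doubleton_eq_iff)

lemma finite_bonds: "finite (bonds B)"
  by (simp add: bonds_def)

text \<open>An incomplete half has at most four edges, and a half in \<open>W\<close> falls one
  short of that. The surplus of the complete halves is later cancelled by
  \<open>components_lower\<close>.\<close>

lemma sum_card_halves:
  assumes "W \<subseteq> {..<2*B}" and W: "\<And>h. h \<in> W \<Longrightarrow> card (M \<inter> half_cycle h) \<le> 3"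
  shows "(\<Sum>h<2*B. card (M \<inter> half_cycle h)) + card W \<le> 8*B + card {h. h < 2*B \<and> half_cycle h \<subseteq> M}"
proof -
  have "(\<Sum>h<2*B. card (M \<inter> half_cycle h) + of_bool (h \<in> W)) \<le> (\<Sum>h<2*B. 4 + of_bool (half_cycle h \<subseteq> M))"
    using card_half[of M] W by (intro sum_mono) (fastforce simp: of_bool_def split: if_splits)
  moreover have "(\<Sum>h<2*B. of_bool (h \<in> W)) = card W"
    using assms(1) by (simp add: Int_absorb1 Int_def[symmetric] of_bool_def sum.If_cases Collect_mem_eq)
  moreover have "(\<Sum>h<2*B. of_bool (half_cycle h \<subseteq> M)) = card {h. h < 2*B \<and> half_cycle h \<subseteq> M}"
    by (simp add: of_bool_def sum.If_cases Int_def lessThan_def)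
  ultimately show ?thesis by (simp add: sum.distrib)
qed

text \<open>Let x bonds be removed and y joins be added. The complete 5-cycles cancel, leaving at
  least B + card W + x - y components. Since x + y = card F < card V \<le> card W + 2x, this exceeds
  B.\<close>

lemma more_components:
  assumes M: "two_matching (10*B) M" "M \<subseteq> cheap B J"
    and F: "F = (bonds B - M) \<union> (M \<inter> J)" "F \<noteq> {}" "card F \<le> k"
  shows "B < num_comps (10*B) M"
proof -
  define V where "V = (\<lambda>v. v div 5) ` \<Union>F"
  define W where "W = {h \<in> V. bond (h div 2) \<in> M}"
  have fin: "finite M" using M two_matching_finite by blast
  have "F \<subseteq> cheap B J" using F(1) by (auto simp: cheap_def)
  then have F_kn: "F \<subseteq> kn_edges (10*B)" using cheap_edges by blast
  have "v div 5 < 2*B" if "e \<in> F" "v \<in> e" for e v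
    using F_kn that by (fastforce simp: kn_edges_def vertices_def)
  then have V_sub: "V \<subseteq> {..<2*B}" by (auto simp: V_def)
  then have W_sub: "W \<subseteq> {..<2*B}" by (auto simp: W_def)
  have W3: "card (M \<inter> half_cycle h) \<le> 3" if hW: "h \<in> W" for h
  proof -
    obtain e v where e: "e \<in> F" "v \<in> e" "v div 5 = h" and b: "bond (h div 2) \<in> M"
      using hW by (auto simp: W_def V_def)
    \<comment> \<open>A half in \<open>W\<close> keeps its bond, so the member of \<open>F\<close>
      meeting it is an added join.\<close>
    have "e \<in> M \<inter> J"
    proof (rule ccontr)
      assume "e \<notin> M \<inter> J"
      then obtain g where "e = bond g" "e \<notin> M" using e(1) F(1) by (auto simp: bonds_def)
      then show False using bond_div[of v g] e b by simp
    qed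
    then show ?thesis using card_half_with_join[OF M(1) _ b] e W_sub hW by blast
  qed
  \<comment> \<open>The halves in \<open>V - W\<close> are ends of removed bonds, two for each
    bond.\<close>
  have R: "card (V - W) \<le> 2 * card (bonds B - M)"
  proof -
    have "V - W \<subseteq> (\<Union>e\<in>bonds B - M. (\<lambda>v. v div 5) ` e)"
    proof
      fix h assume h: "h \<in> V - W"
      have "h div 2 < B" using h V_sub by auto
      then have "bond (h div 2) \<in> bonds B - M" using h by (auto simp: W_def bonds_def)
      moreover have "h \<in> (\<lambda>v. v div 5) ` bond (h div 2)"
        using port_bond[of h] port_div[of h] by (metis imageI)
      ultimately show "h \<in> (\<Union>e\<in>bonds B - M. (\<lambda>v. v div 5) ` e)" by blast
    qed
    then have "card (V - W) \<le> card (\<Union>e\<in>bonds B - M. (\<lambda>v. v div 5) ` e)"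
      using finite_bonds by (intro card_mono) (auto simp: bonds_def bond_def)
    also have "\<dots> \<le> (\<Sum>e\<in>bonds B - M. card ((\<lambda>v. v div 5) ` e))"
      using finite_bonds by (intro card_UN_le) auto
    also have "\<dots> \<le> (\<Sum>e\<in>bonds B - M. 2)"
      by (intro sum_mono) (auto simp: bonds_def bond_def card_insert_if)
    finally show ?thesis by simp
  qed
  have "finite V" using V_sub finite_subset by blast
  then have VW: "card V \<le> card W + 2 * card (bonds B - M)"
  proof -
    have "W \<union> (V - W) = V" by (auto simp: W_def)
    then show ?thesis using R card_Un_le[of W "V - W"] by simp
  qed
  have "F \<subseteq> J \<union> bonds B" using F(1) by auto
  then have "card F < card V" unfolding V_def using girth F by blast
  moreover have "card F = card (bonds B - M) + card (M \<inter> J)"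
    unfolding F(1) using fin finite_bonds join_not_bond
    by (intro card_Un_disjoint) (auto simp: bonds_def)
  moreover have "card (M \<inter> bonds B) + card (bonds B - M) = B"
    using card_bonds card_Int_Diff[OF finite_bonds, of M] by (simp add: Int_commute)
  ultimately show ?thesis
    using components_lower[OF M(1)] card_two_matching[OF M] sum_card_halves[OF W_sub W3] VW
    by linarith
qed

text \<open>Degrees are inherited from the identity tour, which contains the paths.\<close>

lemma paths_two_matching: "two_matching (10*B) (paths B)"
proof -
  have T: "is_tour (10*B) {{id i, id ((i + 1) mod (10*B))} | i. i < 10*B}"
    by (rule is_tour_reindex) (use B_pos in simp, rule bij_betw_id)
  have sub: "paths B \<subseteq> {{id i, id ((i + 1) mod (10*B))} | i. i < 10*B}"
  proof
    fix e assume "e \<in> paths B"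
    then obtain v where v: "e = {v, v + 1}" "v < 10*B" "v mod 10 \<noteq> 9" by (auto simp: paths_def)
    then have "v + 1 < 10*B" by (intro Suc_less_if_not_last)
    then have "(v + 1) mod (10*B) = v + 1" by simp
    then show "e \<in> {{id i, id ((i + 1) mod (10*B))} | i. i < 10*B}"
      using v by (intro CollectI exI[of _ v]) auto
  qed
  have "deg (paths B) v \<le> 2" for v
  proof -
    have "deg (paths B) v \<le> deg {{id i, id ((i + 1) mod (10*B))} | i. i < 10*B} v"
      unfolding deg_def using sub tour_props(1)[OF T] by (intro card_mono) auto
    then show ?thesis using tour_props(4)[OF T, of v] by linarith
  qed
  then show ?thesis using paths_cheap cheap_edges by (auto simp: two_matching_def)
qed

section \<open>The stuck matching and the cost of its output\<close>

definition cost :: "nat set \<Rightarrow> nat" where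
  "cost e = (if e \<in> cheap B J then 1 else 2)"

text \<open>A nonempty \<open>F\<close> strictly increases the number of components. An empty
  \<open>F\<close> leaves at least \<open>B\<close> components and no cycle, and the paths have no
  singletons to lose, so each of the three criteria fails.\<close>

lemma not_improvable: "\<not> improving_move k (10*B) cost (paths B) M"
proof
  assume imp: "improving_move k (10*B) cost (paths B) M"
  then have M: "two_matching (10*B) M" "M \<subseteq> cheap B J"
    by (auto simp: improving_move_def cost_def split: if_splits)
  have fin: "finite M" "finite (paths B)" using M paths_two_matching two_matching_finite by auto
  define F where "F = (bonds B - M) \<union> (M \<inter> J)"
  \<comment> \<open>The paths contain all bonds and no join, so \<open>F\<close> is part of the
    symmetric difference that the move pays for.\<close>
  have "M \<inter> J \<subseteq> M - paths B"
    unfolding paths_eq using join_not_half join_not_bond by (auto simp: bonds_def)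
  moreover have "bonds B - M \<subseteq> paths B - M" unfolding paths_eq by blast
  ultimately have "card F \<le> card ((paths B - M) \<union> (M - paths B))"
    unfolding F_def using fin by (intro card_mono) auto
  also have "\<dots> \<le> k" using imp card_Un_le[of "paths B - M" "M - paths B"] by (auto simp: improving_move_def)
  finally have F_le: "card F \<le> k" .
  show False
  proof (cases "F = {}")
    case False
    then show False using more_components[OF M F_def False F_le] num_comps_paths imp
      by (auto simp: improving_move_def)
  next
    case True
    then have MF: "M \<inter> J = {}" "bonds B \<subseteq> M" by (auto simp: F_def)
    then have "num_cycles (10*B) M = 0" using no_cycles[OF M MF] by (simp add: num_cycles_def)
    moreover have "B \<le> num_comps (10*B) M"
    proof -
      have "M \<inter> bonds B = bonds B" using MF by blast
      then show ?thesis
        using components_lower[OF M(1)] card_two_matching[OF M] sum_card_halves[of "{}" M] card_bonds MF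
        by simp
    qed
    ultimately show False using imp num_singletons_paths num_comps_paths
      by (auto simp: improving_move_def)
  qed
qed

text \<open>Every cheap edge outside the paths meets a bond vertex or the end of a join. These are
  interior to a path and already have degree two, so the \<open>B\<close> edges added to the
  \<open>9*B\<close> path edges all cost 2.\<close>

lemma output_cost:
  assumes "final_tour (10*B) (paths B) T"
  shows "tour_cost cost T \<ge> 11*B"
proof -
  have T: "is_tour (10*B) T" using assms by (simp add: final_tour_def)
  note fin = tour_props(1)[OF T]
  have "cycle_components (10*B) (paths B) = {}"
  proof (rule no_cycles[OF paths_two_matching paths_cheap])
    show "paths B \<inter> J = {}" unfolding paths_eq using join_not_half join_not_bond by (auto simp: bonds_def)
    show "bonds B \<subseteq> paths B" unfolding paths_eq by blast
  qed
  then have sub: "paths B \<subseteq> T" using assms by (auto simp: final_tour_def)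
  have interior: "e \<in> paths B" if "e \<in> T" "v \<in> e" "v < 10*B" "v mod 10 \<noteq> 0" "v mod 10 \<noteq> 9" for e v
  proof (rule ccontr)
    assume no: "e \<notin> paths B"
    have v: "v - 1 + 1 = v" "(v - 1) mod 10 \<noteq> 9" "v - 1 < 10*B"
      using that(3,4) by (cases v; simp add: mod_Suc split: if_splits)+
    have "{v - 1, v - 1 + 1} \<in> paths B" unfolding paths_def using v by blast
    then have e1: "{v - 1, v} \<in> paths B" unfolding v(1) .
    have e2: "{v, v+1} \<in> paths B" using that unfolding paths_def by blast
    have "{v - 1, v} \<noteq> {v, v+1}" by (auto simp: doubleton_eq_iff)
    then show False
      using deg_three[OF fin tour_props(4)[OF T], of e "{v-1,v}" "{v,v+1}" v] e1 e2 sub that no by auto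
  qed
  have two: "cost e = 2" if e: "e \<in> T" "e \<notin> paths B" for e
  proof (rule ccontr)
    assume "cost e \<noteq> 2"
    then have "e \<in> cheap B J" by (auto simp: cost_def split: if_splits)
    then have "(\<exists>h<2*B. e = {5*h, 5*h+4}) \<or> e \<in> J" using e(2) unfolding cheap_def paths_eq by blast
    then have "\<exists>v\<in>e. v < 10*B \<and> v mod 10 \<noteq> 0 \<and> v mod 10 \<noteq> 9"
    proof
      assume "\<exists>h<2*B. e = {5*h, 5*h+4}"
      then obtain h where h: "h < 2*B" "e = {5*h, 5*h+4}" by blast
      have "port h mod 10 \<noteq> 0" "port h mod 10 \<noteq> 9"
        by (cases "even h"; auto simp: port_def elim!: evenE oddE)+
      then show ?thesis using h by (intro bexI[of _ "port h"]) (auto simp: port_def)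
    next
      assume "e \<in> J"
      then obtain u v where uv: "e = {u, v}" "u < 10*B" "u mod 10 \<in> {1, 2, 7, 8}"
        using join_ports by blast
      then have "u mod 10 \<noteq> 0" "u mod 10 \<noteq> 9" by auto
      then show ?thesis using uv by blast
    qed
    then show False using interior e by blast
  qed
  have "tour_cost cost T = (\<Sum>e\<in>paths B. cost e) + (\<Sum>e\<in>T - paths B. cost e)"
    unfolding tour_cost_def using sum.subset_diff[OF sub fin, of cost] by simp
  moreover have "(\<Sum>e\<in>paths B. cost e) = card (paths B)"
    using paths_cheap by (subst card_eq_sum, intro sum.cong) (auto simp: cost_def)
  moreover have "(\<Sum>e\<in>T - paths B. cost e) = 2 * card (T - paths B)"
    using two by simp
  moreover have "card (T - paths B) = 10*B - 9*B"
    using sub fin tour_props(2)[OF T] card_paths by (simp add: card_Diff_subset finite_subset)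
  ultimately show ?thesis using card_paths by simp
qed

text \<open>The cheap edges of the identity tour are exactly the paths. No move improves them, so
  every run stops at once.\<close>

lemma locally_optimal_tour:
  assumes k: "j \<le> k"
  shows "\<exists>T. is_tour (10*B) T \<and> (\<forall>T'. kimprov_output j (10*B) cost T T' \<longrightarrow> 11*B \<le> tour_cost cost T')"
proof -
  define T where "T = {{id i, id ((i + 1) mod (10*B))} | i. i < 10*B}"
  have T: "is_tour (10*B) T" unfolding T_def
    by (rule is_tour_reindex) (use B_pos in simp, rule bij_betw_id)
  have cheapT: "{e \<in> T. cost e = 1} = paths B"
  proof (rule set_eqI, rule iffI)
    fix e assume "e \<in> {e \<in> T. cost e = 1}"
    then obtain v where v: "v < 10*B" "e = {v, (v + 1) mod (10*B)}" and c: "e \<in> cheap B J"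
      by (auto simp: T_def cost_def split: if_splits)
    show "e \<in> paths B"
    proof (cases "v mod 10 = 9")
      case False
      then have "v + 1 < 10*B" using v(1) by (intro Suc_less_if_not_last)
      then have "e = {v, v + 1}" using v by simp
      then show ?thesis unfolding paths_def using v False by blast
    next
      case True
      define w where "w = (v + 1) mod (10*B)"
      have "w mod 10 = 0" using True unfolding w_def by (simp add: mod_mod_cancel mod_Suc)
      have v_in: "v \<in> e" "w \<in> e" using v by (auto simp: w_def)
      \<comment> \<open>The edge leaving a gadget runs from residue 9 to residue 0, also when it
        wraps around, hence between halves of opposite parity.\<close>
      have "v div 5 mod 2 \<noteq> w div 5 mod 2"
        using True \<open>w mod 10 = 0\<close> mod_mult2_eq[of v 5 2] mod_mult2_eq[of w 5 2] by auto
      then have "v div 5 \<noteq> w div 5" by auto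
      then have "e \<notin> half_cycle h" for h using half_cycle_div v_in by metis
      moreover have "e \<notin> J"
      proof
        assume "e \<in> J"
        then have "v mod 10 \<in> {1, 2, 7, 8}" using join_ports v_in(1) by blast
        then show False using True by simp
      qed
      moreover have "e \<noteq> bond g" for g
      proof
        assume "e = bond g"
        then have "v mod 10 = 4 \<or> v mod 10 = 5" using v_in(1) by (auto simp: bond_def)
        then show False using True by simp
      qed
      ultimately show ?thesis using c by (auto simp: cheap_def bonds_def)
    qed
  next
    fix e assume e: "e \<in> paths B"
    then obtain v where v: "e = {v, v + 1}" "v < 10*B" "v mod 10 \<noteq> 9" by (auto simp: paths_def)
    then have "v + 1 < 10*B" by (intro Suc_less_if_not_last)
    then have "(v + 1) mod (10*B) = v + 1" by simp
    then show "e \<in> {e \<in> T. cost e = 1}"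
      using v e paths_cheap by (auto simp: T_def cost_def)
  qed
  have stuck: "\<not> improving_move j (10*B) cost (paths B) M" for M
    using not_improvable[of M] k by (auto simp: improving_move_def)
  have "11*B \<le> tour_cost cost T'" if out: "kimprov_output j (10*B) cost T T'" for T'
  proof -
    obtain M where M: "(paths B, M) \<in> (improv_step j (10*B) cost)\<^sup>*" and f: "final_tour (10*B) M T'"
      using out unfolding kimprov_output_def cheapT by blast
    from M have "M = paths B"
    proof (cases rule: converse_rtranclE)
      case (step M')
      then show ?thesis using stuck[of M'] by (simp add: improv_step_def)
    qed simp
    then show ?thesis using f output_cost by blast
  qed
  then show ?thesis using T by blast
qed

end

subsection \<open>Gadget graphs of large girth\<close>

text \<open>The members of \<open>F\<close> are edges given by their ends, and \<open>\<nu>\<close>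
  maps an end to its node; disjointness lets an end determine its edge. Without short
  non-backtracking closed walks the graph is a forest: a leaf is removed by induction, and if there
  is no leaf, a walk continues until a node repeats.\<close>

lemma card_less_nodes_if_no_closed_walk:
  fixes F :: "'a set set" and \<nu> :: "'a \<Rightarrow> 'b"
  assumes "finite F" "F \<noteq> {}" "card F \<le> k"
    and "\<And>e. e \<in> F \<Longrightarrow> card e = 2"
    and "\<And>e e'. \<lbrakk>e \<in> F; e' \<in> F; e \<inter> e' \<noteq> {}\<rbrakk> \<Longrightarrow> e = e'"
    and "\<And>a b l. \<lbrakk>l < 2*k; \<forall>j\<le>l. {a j, b j} \<in> F;
           \<forall>j<l. \<nu> (a (Suc j)) = \<nu> (b j) \<and> a (Suc j) \<noteq> b j\<rbrakk> \<Longrightarrow> \<nu> (b l) \<noteq> \<nu> (a 0)"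
  shows "card F < card (\<nu> ` \<Union>F)"
  using assms
proof (induction F rule: finite_psubset_induct)
  case (psubset F)
  note two = psubset.prems(3) and disj = psubset.prems(4) and walk = psubset.prems(5)
  define D where "D = \<Union>F"
  have "finite e" if "e \<in> F" for e using two[OF that] card.infinite by fastforce
  then have finD: "finite D" unfolding D_def using psubset.hyps by blast
  have "\<exists>x. {d, x} \<in> F \<and> x \<noteq> d" if dD: "d \<in> D" for d
  proof -
    obtain e where e: "e \<in> F" "d \<in> e" using dD by (auto simp: D_def)
    then obtain u v where "e = {u, v}" "u \<noteq> v" using two[OF e(1)] by (auto simp: card_2_iff)
    then show ?thesis using e by (cases "d = u") (auto simp: insert_commute)
  qed
  then obtain p where p: "\<And>d. d \<in> D \<Longrightarrow> {d, p d} \<in> F \<and> p d \<noteq> d" by metis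
  have pD: "p d \<in> D" if "d \<in> D" for d using p[OF that] by (auto simp: D_def)
  have "card D \<le> (\<Sum>e\<in>F. card e)" unfolding D_def by (rule card_Union_le_sum_card)
  also have "\<dots> = 2 * card F" using two by simp
  finally have "card D \<le> 2 * k" using psubset.prems(2) by linarith
  \<comment> \<open>This bounds the length of the walk that the pigeonhole principle closes.\<close>
  then have card_nodes: "card (\<nu> ` D) \<le> 2 * k" using card_image_le[OF finD, of \<nu>] by linarith
  obtain e where "e \<in> F" using psubset.prems(1) by blast
  then have "e \<noteq> {}" using two[of e] by auto
  then obtain d0 where d0: "d0 \<in> D" using \<open>e \<in> F\<close> by (auto simp: D_def)
  show ?case
  proof (cases "\<forall>d\<in>D. \<exists>d'\<in>D. d' \<noteq> d \<and> \<nu> d' = \<nu> d")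
    case True
    then obtain nxt where nxt: "\<And>d. d \<in> D \<Longrightarrow> nxt d \<in> D \<and> nxt d \<noteq> d \<and> \<nu> (nxt d) = \<nu> d" by metis
    define a where "a j = ((\<lambda>d. nxt (p d)) ^^ j) d0" for j
    have a_Suc: "a (Suc j) = nxt (p (a j))" for j by (simp add: a_def)
    have aD: "a j \<in> D" for j
    proof (induction j)
      case 0
      show ?case by (simp add: a_def d0)
    next
      case (Suc j)
      then show ?case using nxt pD by (simp add: a_Suc)
    qed
    have "\<not> inj_on (\<lambda>j. \<nu> (a j)) {..card (\<nu> ` D)}"
    proof
      assume "inj_on (\<lambda>j. \<nu> (a j)) {..card (\<nu> ` D)}"
      then have "card {..card (\<nu> ` D)} \<le> card (\<nu> ` D)"
        using finD aD by (intro card_inj_on_le) auto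
      then show False by simp
    qed
    then obtain i j where ij: "i < j" "j \<le> card (\<nu> ` D)" "\<nu> (a i) = \<nu> (a j)"
      unfolding inj_on_def by (metis atMost_iff linorder_neqE_nat)
    \<comment> \<open>The closed walk consists of the edges leaving \<open>a i\<close> up to
      \<open>a (j - 1)\<close>, so its last index is \<open>l\<close>.\<close>
    define l where "l = j - Suc i"
    have j: "j = Suc (i + l)" using ij by (simp add: l_def)
    have "\<nu> (p (a (i + l))) \<noteq> \<nu> (a (i + 0))"
    proof (rule walk[where a = "\<lambda>t. a (i + t)" and b = "\<lambda>t. p (a (i + t))" and l = l])
      show "l < 2*k" using ij card_nodes j by linarith
      show "\<forall>t\<le>l. {a (i + t), p (a (i + t))} \<in> F" using p aD by blast
      show "\<forall>t<l. \<nu> (a (i + Suc t)) = \<nu> (p (a (i + t))) \<and> a (i + Suc t) \<noteq> p (a (i + t))"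
        using nxt pD aD by (simp add: a_Suc)
    qed
    moreover have "\<nu> (p (a (i + l))) = \<nu> (a j)" using nxt pD aD by (simp add: j a_Suc)
    ultimately show ?thesis using ij by simp
  next
    case False
    \<comment> \<open>The end \<open>d\<close> is alone at its node. Deleting its edge removes one
      edge and at least that node.\<close>
    then obtain d where d: "d \<in> D" "\<And>d'. d' \<in> D \<Longrightarrow> d' \<noteq> d \<Longrightarrow> \<nu> d' \<noteq> \<nu> d" by blast
    define F' where "F' = F - {{d, p d}}"
    have e: "{d, p d} \<in> F" using p d by blast
    have card_F: "card F = Suc (card F')"
      unfolding F'_def using e psubset.hyps by (metis card.remove)
    show ?thesis
    proof (cases "F' = {}")
      case True
      have "F = {{d, p d}}" using True e by (auto simp: F'_def)
      then have "\<Union>F = {d, p d}" by simp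
      then show ?thesis using card_F True d(2)[OF pD[OF d(1)]] p[OF d(1)] by auto
    next
      case nonempty: False
      have sub: "F' \<subset> F" unfolding F'_def using e by blast
      have "card F' < card (\<nu> ` \<Union>F')"
      proof (rule psubset.IH[OF sub nonempty])
        show "card F' \<le> k" using card_F psubset.prems(2) by simp
        show "card e = 2" if "e \<in> F'" for e using that two sub by blast
        show "e = e'" if "e \<in> F'" "e' \<in> F'" "e \<inter> e' \<noteq> {}" for e e' using that disj sub by blast
        show "\<nu> (b l) \<noteq> \<nu> (a 0)" if "l < 2*k" "\<forall>j\<le>l. {a j, b j} \<in> F'"
          "\<forall>j<l. \<nu> (a (Suc j)) = \<nu> (b j) \<and> a (Suc j) \<noteq> b j" for a b l
          using that sub by (intro walk) blast+
      qed
      moreover have "\<nu> ` \<Union>F' \<subseteq> \<nu> ` D - {\<nu> d}"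
      proof -
        have "d \<notin> \<Union>F'" using disj[OF _ e] by (fastforce simp: F'_def)
        moreover have "\<Union>F' \<subseteq> D" by (auto simp: F'_def D_def)
        ultimately have "\<nu> x \<in> \<nu> ` D - {\<nu> d}" if "x \<in> \<Union>F'" for x
          using d(2)[of x] that by blast
        then show ?thesis by (rule image_subsetI)
      qed
      then have "card (\<nu> ` \<Union>F') \<le> card (\<nu> ` D - {\<nu> d})" using finD by (intro card_mono) auto
      moreover have "Suc (card (\<nu> ` D - {\<nu> d})) = card (\<nu> ` D)"
        using finD d(1) by (intro card.remove[symmetric]) auto
      ultimately show ?thesis using card_F by (simp add: D_def)
    qed
  qed
qed

section \<open>Involutions without short relations\<close>

definition words :: "nat \<Rightarrow> nat \<Rightarrow> nat list set" where
  "words m r = {w. set w \<subseteq> {..<m} \<and> length w \<le> r \<and> distinct_adj w}"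

text \<open>Left multiplication by generator \<open>i\<close> in the free product of
  \<open>m\<close> groups of order two, with \<open>words m r\<close> as the ball of radius
  \<open>r\<close>. Where the product would leave the ball the word stays fixed, which keeps the map
  an involution.\<close>

definition toggle :: "nat \<Rightarrow> nat \<Rightarrow> nat \<Rightarrow> nat list \<Rightarrow> nat list" where
  "toggle m r i w =
     (if w \<in> words m r then
        if w \<noteq> [] \<and> hd w = i then tl w else if length w < r then i # w else w
      else w)"

lemma toggle_Cons:
  "i # w \<in> words m r \<Longrightarrow> toggle m r i w = i # w"
  by (cases w) (auto simp: toggle_def words_def)

lemma toggle_toggle:
  assumes "i < m" shows "toggle m r i (toggle m r i w) = w"
proof (cases "w \<in> words m r")
  case True
  show ?thesis
  proof (cases "w \<noteq> [] \<and> hd w = i")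
    case T: True
    then obtain v where v: "w = i # v" by (cases w) auto
    then have "toggle m r i w = v" using True by (simp add: toggle_def)
    then show ?thesis using toggle_Cons True v by simp
  next
    case False
    show ?thesis
    proof (cases "length w < r")
      case T: True
      then have "toggle m r i w = i # w" using True False by (auto simp: toggle_def)
      moreover have "i # w \<in> words m r"
        using True False T assms by (cases w) (auto simp: words_def)
      ultimately show ?thesis by (simp add: toggle_def[of m r i "i # w"])
    next
      case F: False
      then have "toggle m r i w = w" using False by (auto simp: toggle_def)
      then show ?thesis by simp
    qed
  qed
qed (simp add: toggle_def)

lemma toggle_permutes: "i < m \<Longrightarrow> toggle m r i permutes words m r"
  unfolding permutes_def
  by (metis toggle_def toggle_toggle)

lemma finite_words: "finite (words m r)"
  by (rule finite_subset[OF _ finite_lists_length_le[of "{..<m}" r]]) (auto simp: words_def)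

text \<open>The involutions define a graph on \<open>Q\<close> rows, and \<open>no_relation\<close>
  is its girth condition: no reduced closed walk has length up to \<open>r\<close>.\<close>

locale cover =
  fixes m Q r :: nat and \<pi> :: "nat \<Rightarrow> nat \<Rightarrow> nat"
  assumes m_pos: "m > 0" and Q_pos: "Q > 0"
    and \<pi>_less: "\<lbrakk>i < m; q < Q\<rbrakk> \<Longrightarrow> \<pi> i q < Q"
    and \<pi>_\<pi>: "\<lbrakk>i < m; q < Q\<rbrakk> \<Longrightarrow> \<pi> i (\<pi> i q) = q"
    and no_relation: "\<lbrakk>L \<noteq> []; length L \<le> r; distinct_adj L; set L \<subseteq> {..<m}; q < Q\<rbrakk> \<Longrightarrow> foldr \<pi> L q \<noteq> q"

text \<open>The rows are the permutations of the set of words, and column \<open>i\<close> composes them with \<open>toggle i\<close>.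
  A product of toggles along a reduced word moves the empty word to that word, hence is not the identity.
\<close>

lemma ex_cover:
  assumes "m > 0"
  obtains Q \<pi> where "cover m Q r \<pi>"
proof -
  \<comment> \<open>Composition acts freely on permutations, so a product of toggles fixing a single
    row is the identity. On the words themselves a toggle may have fixed points, namely words of
    maximal length.\<close>
  define S where "S = {p. p permutes words m r}"
  define Q where "Q = card S"
  have finS: "finite S" unfolding S_def by (rule finite_permutations[OF finite_words])
  have "id \<in> S" by (simp add: S_def permutes_id)
  then have Q: "Q > 0" using finS by (auto simp: Q_def card_gt_0_iff)
  obtain h where h: "bij_betw h {0..<Q} S"
    using ex_bij_betw_nat_finite[OF finS] by (auto simp: Q_def)
  define h' where "h' = inv_into {0..<Q} h"
  define \<pi> where "\<pi> i q = h' (h q \<circ> toggle m r i)" for i q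
  have hS: "h q \<in> S" if "q < Q" for q using bij_betwE[OF h] that by simp
  have step: "h q \<circ> toggle m r i \<in> S" if "i < m" "q < Q" for i q
    using hS[OF that(2)] toggle_permutes[OF that(1)] by (auto simp: S_def intro: permutes_compose)
  have h'S: "h' p < Q" "h (h' p) = p" if "p \<in> S" for p
    using that h bij_betw_inv_into_right[OF h that] inv_into_into[of p h "{0..<Q}"]
    by (auto simp: h'_def bij_betw_def)
  have \<pi>_less: "\<pi> i q < Q" if "i < m" "q < Q" for i q
    using h'S(1)[OF step[OF that]] by (simp add: \<pi>_def)
  have h\<pi>: "h (\<pi> i q) = h q \<circ> toggle m r i" if "i < m" "q < Q" for i q
    using h'S(2)[OF step[OF that]] by (simp add: \<pi>_def)
  have h_inj: "q = q'" if "h q = h q'" "q < Q" "q' < Q" for q q'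
    using h that by (auto simp: bij_betw_def inj_on_def)
  show thesis
  proof (rule that, unfold_locales)
    show "m > 0" "Q > 0" by fact+
    show "\<pi> i q < Q" if "i < m" "q < Q" for i q using \<pi>_less that .
    show "\<pi> i (\<pi> i q) = q" if iq: "i < m" "q < Q" for i q
      using iq \<pi>_less[of i "\<pi> i q"] \<pi>_less[OF iq] h\<pi>[of i "\<pi> i q"] h\<pi>[OF iq]
      by (intro h_inj) (auto simp: fun_eq_iff toggle_toggle)
  next
    fix L q assume L: "L \<noteq> []" "length L \<le> r" "distinct_adj L" "set L \<subseteq> {..<m}" and q: "q < Q"
    \<comment> \<open>Toggles are composed on the right, so the head of \<open>L\<close> acts first
      on a word and the letters pile up as \<open>rev L\<close>. The general \<open>w\<close> serves
      the induction; the empty word is what is used.\<close>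
    have fold: "foldr \<pi> L q < Q \<and> (\<forall>w. rev L @ w \<in> words m r \<longrightarrow> h (foldr \<pi> L q) w = h q (rev L @ w))"
      using L(4)
    proof (induction L)
      case (Cons i L)
      then have i: "i < m" and IH: "foldr \<pi> L q < Q"
        "\<And>w. rev L @ w \<in> words m r \<Longrightarrow> h (foldr \<pi> L q) w = h q (rev L @ w)" by auto
      have "h (foldr \<pi> (i # L) q) w = h q (rev (i # L) @ w)" if w: "rev (i # L) @ w \<in> words m r" for w
      proof -
        have "i # w \<in> words m r" using w by (auto simp: words_def distinct_adj_append_iff)
        then show ?thesis using h\<pi>[OF i IH(1)] IH(2)[of "i # w"] w by (simp add: toggle_Cons)
      qed
      then show ?case using \<pi>_less[OF i IH(1)] by simp
    qed (simp add: q)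
    show "foldr \<pi> L q \<noteq> q"
    proof
      assume eq: "foldr \<pi> L q = q"
      have "rev L @ [] \<in> words m r" using L by (auto simp: words_def)
      then have "h q [] = h q (rev L)" using fold eq by (metis append_Nil2)
      moreover have "inj (h q)" using hS[OF q] by (auto simp: S_def permutes_inj)
      ultimately show False using L(1) by (auto dest: injD)
    qed
  qed
qed

section \<open>The lifted ladder and its coordinates\<close>

context cover
begin


text \<open>The half in row \<open>q\<close> and column \<open>i\<close> on side \<open>s\<close>. Gadget \<open>m * p + i\<close> bonds row \<open>p\<close> of side 0
  to row \<open>\<pi> i p\<close> of side 1; since \<open>\<pi> i\<close> is an involution, \<open>row s q i\<close> recovers \<open>p\<close>.\<close>

definition row :: "nat \<Rightarrow> nat \<Rightarrow> nat \<Rightarrow> nat" where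
  "row s q i = (if s = 0 then q else \<pi> i q)"

definition half :: "nat \<Rightarrow> nat \<Rightarrow> nat \<Rightarrow> nat" where
  "half s q i = 2 * (m * row s q i + i) + s"

text \<open>Uniformly in the side, \<open>inp\<close> and \<open>outp\<close> are the two vertices
  not adjacent to the bond vertex \<open>bp\<close>: offsets 1 and 2 on side 0, where
  \<open>bp\<close> has offset 4, and 2 and 3 on side 1, where it has offset 0.\<close>

definition outp :: "nat \<Rightarrow> nat \<Rightarrow> nat \<Rightarrow> nat" where
  "outp s q i = 5 * half s q i + 2 + s"

definition inp :: "nat \<Rightarrow> nat \<Rightarrow> nat \<Rightarrow> nat" where
  "inp s q i = 5 * half s q i + 1 + s"

definition bp :: "nat \<Rightarrow> nat \<Rightarrow> nat \<Rightarrow> nat" where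
  "bp s q i = 5 * half s q i + 4 * (1 - s)"

definition valid :: "nat \<Rightarrow> nat \<Rightarrow> nat \<Rightarrow> bool" where
  "valid s q i \<longleftrightarrow> s < 2 \<and> q < Q \<and> i < m"

text \<open>A row is an open path over the columns: nothing leads from the last column back to the
  first, so a row by itself has no closed walk.\<close>

definition joins :: "nat set set" where
  "joins = {{outp s q i, inp s q (Suc i)} | s q i. valid s q (Suc i)}"

lemma row_less: "valid s q i \<Longrightarrow> row s q i < Q"
  using \<pi>_less by (auto simp: row_def valid_def)

lemma half_inj:
  assumes "half s q i = half s' q' i'" "valid s q i" "valid s' q' i'"
  shows "s = s' \<and> q = q' \<and> i = i'"
proof -
  have s: "s < 2" "s' < 2" using assms by (auto simp: valid_def)
  have "s = half s q i mod 2" "s' = half s' q' i' mod 2" using s unfolding half_def by (simp_all only: mod_mult_self4 mod_less)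
  then have ss: "s = s'" using assms(1) by simp
  then have eq: "m * row s q i + i = m * row s q' i' + i'" using assms(1) by (simp add: half_def)
  have i: "i < m" "i' < m" using assms by (auto simp: valid_def)
  have "i = (m * row s q i + i) mod m" "i' = (m * row s q' i' + i') mod m" using i by auto
  then have ii: "i = i'" using eq by simp
  then have "row s q i = row s q' i" using eq m_pos by simp
  then have "q = q'" using \<pi>_\<pi> assms i by (metis row_def valid_def)
  then show ?thesis using ss ii by simp
qed

lemma half_less: "valid s q i \<Longrightarrow> half s q i < 2 * (m * Q)"
proof -
  assume v: "valid s q i"
  then have "Suc (row s q i) \<le> Q" "i < m" "s < 2" using row_less by (auto simp: valid_def Suc_le_eq)
  then have "m * Suc (row s q i) \<le> m * Q" by (intro mult_le_mono2)
  then show ?thesis using \<open>i < m\<close> \<open>s < 2\<close> by (simp add: half_def)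
qed

lemma port_div:
  assumes "s < 2"
  shows "outp s q i div 5 = half s q i" "inp s q i div 5 = half s q i" "bp s q i div 5 = half s q i"
  using assms by (auto simp: outp_def inp_def bp_def)

lemma port_mod:
  assumes "s < 2"
  shows "outp s q i mod 10 = (if s = 0 then 2 else 8)" "inp s q i mod 10 = (if s = 0 then 1 else 7)"
    "bp s q i mod 10 = (if s = 0 then 4 else 5)"
proof -
  define X where "X = m * row s q i + i"
  have *: "outp s q i = 10 * X + 5 * s + 2 + s" "inp s q i = 10 * X + 5 * s + 1 + s"
    "bp s q i = 10 * X + 5 * s + 4 * (1 - s)"
    by (simp_all add: outp_def inp_def bp_def half_def X_def)
  have "s = 0 \<or> s = 1" using assms by linarith
  then have "(10 * X + 5 * s + 2 + s) mod 10 = (if s = 0 then 2 else 8) \<and>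
    (10 * X + 5 * s + 1 + s) mod 10 = (if s = 0 then 1 else 7) \<and>
    (10 * X + 5 * s + 4 * (1 - s)) mod 10 = (if s = 0 then 4 else 5)"
    by (elim disjE; hypsubst; simp; presburger)
  then show "outp s q i mod 10 = (if s = 0 then 2 else 8)" "inp s q i mod 10 = (if s = 0 then 1 else 7)"
    "bp s q i mod 10 = (if s = 0 then 4 else 5)"
    by (simp_all only: *)
qed

lemma port_less:
  assumes "valid s q i" shows "outp s q i < 10 * (m * Q)" "inp s q i < 10 * (m * Q)"
  using half_less[OF assms] assms by (auto simp: outp_def inp_def valid_def)

lemma outp_inj: "\<lbrakk>outp s q i = outp s' q' i'; valid s q i; valid s' q' i'\<rbrakk> \<Longrightarrow> s = s' \<and> q = q' \<and> i = i'"
  using half_inj port_div by (metis valid_def)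

lemma inp_inj: "\<lbrakk>inp s q i = inp s' q' i'; valid s q i; valid s' q' i'\<rbrakk> \<Longrightarrow> s = s' \<and> q = q' \<and> i = i'"
  using half_inj port_div by (metis valid_def)

lemma outp_neq_inp: "\<lbrakk>valid s q i; valid s' q' i'\<rbrakk> \<Longrightarrow> outp s q i \<noteq> inp s' q' i'"
  using port_mod(1)[of s q i] port_mod(2)[of s' q' i'] by (auto simp: valid_def split: if_splits)

text \<open>Gadget \<open>g\<close> sits in row \<open>g div m\<close> and column
  \<open>g mod m\<close>. Its side 1 has row index \<open>\<pi> i q\<close>, because
  \<open>row\<close> applies the involution once more.\<close>

lemma bond_bp:
  assumes "g < m * Q"
  obtains q i where "valid 0 q i" "bond g = {bp 0 q i, bp 1 (\<pi> i q) i}"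
proof -
  define q i where "q = g div m" and "i = g mod m"
  have v: "valid 0 q i" using assms m_pos by (auto simp: valid_def q_def i_def less_mult_imp_div_less mult.commute)
  have g: "m * q + i = g" by (simp add: q_def i_def)
  have "half 0 q i = 2 * g" "half 1 (\<pi> i q) i = 2 * g + 1"
    using v \<pi>_\<pi>[of i q] g by (auto simp: half_def row_def valid_def)
  then have "bond g = {bp 0 q i, bp 1 (\<pi> i q) i}" by (simp add: bond_def bp_def add.commute)
  then show ?thesis using v that by blast
qed

text \<open>The three ways to leave a half: forwards or backwards along the row, or across the bond.
  Crossing applies \<open>\<pi> i\<close> in both directions because it is an involution.\<close>

lemma oriented_edge:
  assumes "{a, b} \<in> joins \<union> bonds (m * Q)"
  shows "\<exists>s q i. valid s q i \<and> a div 5 = half s q i \<and>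
     (a = outp s q i \<and> valid s q (Suc i) \<and> b = inp s q (Suc i) \<or>
      a = inp s q i \<and> 0 < i \<and> b = outp s q (i - 1) \<or>
      a = bp s q i \<and> b = bp (1 - s) (\<pi> i q) i)"
  using assms
proof
  assume "{a, b} \<in> joins"
  then obtain s q i where v: "valid s q (Suc i)" and "{a, b} = {outp s q i, inp s q (Suc i)}"
    by (auto simp: joins_def)
  then consider "a = outp s q i" "b = inp s q (Suc i)" | "a = inp s q (Suc i)" "b = outp s q i"
    by (auto simp: doubleton_eq_iff)
  then show ?thesis
  proof cases
    case 1
    have "valid s q i" using v by (auto simp: valid_def)
    then show ?thesis using 1 v port_div(1)[of s q i]
      by (intro exI[of _ s] exI[of _ q] exI[of _ i]) (auto simp: valid_def)
  next
    case 2
    then show ?thesis using v port_div(2)[of s q "Suc i"]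
      by (intro exI[of _ s] exI[of _ q] exI[of _ "Suc i"]) (auto simp: valid_def)
  qed
next
  assume "{a, b} \<in> bonds (m * Q)"
  then obtain g where g: "g < m * Q" "{a, b} = bond g" by (auto simp: bonds_def)
  obtain q i where v: "valid 0 q i" and e: "bond g = {bp 0 q i, bp 1 (\<pi> i q) i}" using bond_bp[OF g(1)] .
  have v': "valid 1 (\<pi> i q) i" "\<pi> i (\<pi> i q) = q" using v \<pi>_less \<pi>_\<pi> by (auto simp: valid_def)
  consider "a = bp 0 q i" "b = bp 1 (\<pi> i q) i" | "a = bp 1 (\<pi> i q) i" "b = bp 0 q i"
    using g(2) e by (auto simp: doubleton_eq_iff)
  then show ?thesis
  proof cases
    case 1
    then show ?thesis using v port_div(3)[of 0 q i]
      by (intro exI[of _ 0] exI[of _ q] exI[of _ i]) auto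
  next
    case 2
    then show ?thesis using v' port_div(3)[of 1 "\<pi> i q" i]
      by (intro exI[of _ 1] exI[of _ "\<pi> i q"] exI[of _ i]) auto
  qed
qed

text \<open>A walk changes the row only when it crosses a bond, and between two bonds it moves
  monotonically along a row. The list \<open>L\<close> collects the columns of the bonds crossed so far, the most
  recent one first; \<open>i\<^sub>0\<close> is the starting column.\<close>

definition reached :: "nat \<Rightarrow> nat \<Rightarrow> nat \<Rightarrow> nat \<Rightarrow> nat \<Rightarrow> nat \<Rightarrow> nat \<Rightarrow> nat list \<Rightarrow> bool" where
  "reached q0 i0 l b s q i L \<longleftrightarrow> valid s q i \<and> b div 5 = half s q i \<and> q = foldr \<pi> L q0 \<and>
     set L \<subseteq> {..<m} \<and> length L \<le> l \<and> distinct_adj L \<and>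
     (b = inp s q i \<and> hd (L @ [i0]) < i \<or> b = outp s q i \<and> i < hd (L @ [i0]) \<or>
      b = bp s q i \<and> L \<noteq> [] \<and> i = hd (L @ [i0]))"

lemma reached_start:
  assumes e: "{a, b} \<in> joins \<union> bonds (m * Q)" and v: "valid s0 q0 i0" and a: "a div 5 = half s0 q0 i0"
  shows "\<exists>s q i L. reached q0 i0 1 b s q i L"
proof -
  obtain s q i where "valid s q i" and "a div 5 = half s q i" and
     *: "a = outp s q i \<and> valid s q (Suc i) \<and> b = inp s q (Suc i) \<or>
      a = inp s q i \<and> 0 < i \<and> b = outp s q (i - 1) \<or>
      a = bp s q i \<and> b = bp (1 - s) (\<pi> i q) i"
    using oriented_edge[OF e] by blast
  then have eq: "s = s0" "q = q0" "i = i0" using half_inj a v by metis+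
  from * show ?thesis unfolding eq
  proof (elim disjE conjE)
    assume "valid s0 q0 (Suc i0)" "b = inp s0 q0 (Suc i0)"
    then show ?thesis
      by (intro exI[of _ s0] exI[of _ q0] exI[of _ "Suc i0"] exI[of _ "[]"])
         (auto simp: reached_def port_div valid_def)
  next
    assume "0 < i0" "b = outp s0 q0 (i0 - 1)"
    then show ?thesis using v
      by (intro exI[of _ s0] exI[of _ q0] exI[of _ "i0 - 1"] exI[of _ "[]"])
         (auto simp: reached_def port_div valid_def)
  next
    assume "b = bp (1 - s0) (\<pi> i0 q0) i0"
    then show ?thesis using v
      by (intro exI[of _ "1 - s0"] exI[of _ "\<pi> i0 q0"] exI[of _ i0] exI[of _ "[i0]"])
         (auto simp: reached_def port_div valid_def \<pi>_less)
  qed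
qed

text \<open>As \<open>a\<close> differs from the arrival vertex \<open>b\<close>, a walk along a row
  cannot turn round. It can thus cross a bond only in a column other than that of the previous bond,
  which keeps \<open>L\<close> reduced.\<close>

lemma reached_step:
  assumes R: "reached q0 i0 l b s q i L" and e: "{a, b'} \<in> joins \<union> bonds (m * Q)"
    and a: "a div 5 = b div 5" "a \<noteq> b"
  shows "\<exists>s q i L. reached q0 i0 (Suc l) b' s q i L"
proof -
  define x where "x = hd (L @ [i0])"
  have v: "valid s q i" "b div 5 = half s q i" and q: "foldr \<pi> L q0 = q"
    and L: "set L \<subseteq> {..<m}" "length L \<le> l" "distinct_adj L"
    and st: "b = inp s q i \<and> x < i \<or> b = outp s q i \<and> i < x \<or> b = bp s q i \<and> L \<noteq> [] \<and> i = x"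
    using R unfolding reached_def x_def by blast+
  have s: "s < 2" "1 - s < 2" "i < m" "q < Q" using v(1) by (auto simp: valid_def)
  obtain s' q' i' where "valid s' q' i'" and "a div 5 = half s' q' i'" and
     *: "a = outp s' q' i' \<and> valid s' q' (Suc i') \<and> b' = inp s' q' (Suc i') \<or>
      a = inp s' q' i' \<and> 0 < i' \<and> b' = outp s' q' (i' - 1) \<or>
      a = bp s' q' i' \<and> b' = bp (1 - s') (\<pi> i' q') i'"
    using oriented_edge[OF e] by blast
  then have eq: "s' = s" "q' = q" "i' = i" using half_inj a v by metis+
  from * show ?thesis unfolding eq
  proof (elim disjE conjE)
    assume b': "valid s q (Suc i)" "b' = inp s q (Suc i)" "a = outp s q i"
    have "x < Suc i" using st a(2) b'(3) by linarith
    then have "reached q0 i0 (Suc l) b' s q (Suc i) L"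
      using b' q L port_div[OF s(1)] by (simp add: reached_def x_def)
    then show ?thesis by blast
  next
    assume b': "0 < i" "b' = outp s q (i - 1)" "a = inp s q i"
    have "i - 1 < x" using st a(2) b'(1,3) by linarith
    moreover have "valid s q (i - 1)" using v(1) by (auto simp: valid_def)
    ultimately have "reached q0 i0 (Suc l) b' s q (i - 1) L"
      using b' q L port_div[OF s(1)] by (simp add: reached_def x_def)
    then show ?thesis by blast
  next
    assume b': "b' = bp (1 - s) (\<pi> i q) i" "a = bp s q i"
    have "i \<noteq> x" using st a(2) b'(2) by auto
    then have "distinct_adj (i # L)" using L(3) by (cases L) (auto simp: x_def)
    moreover have "valid (1 - s) (\<pi> i q) i" using s \<pi>_less by (simp add: valid_def)
    ultimately have "reached q0 i0 (Suc l) b' (1 - s) (\<pi> i q) i (i # L)"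
      using b' q L s(3) port_div[OF s(2)] by (simp add: reached_def)
    then show ?thesis by blast
  qed
qed

text \<open>Returning to the starting half makes the product along \<open>L\<close> fix
  \<open>q0\<close>. Moreover \<open>L\<close> is nonempty, because before the first bond the
  current column differs from the starting one; \<open>no_relation\<close> excludes this.\<close>

lemma no_closed_walk:
  assumes l: "l < r" and e: "\<forall>j\<le>l. {a j, b j} \<in> joins \<union> bonds (m * Q)"
    and w: "\<forall>j<l. a (Suc j) div 5 = b j div 5 \<and> a (Suc j) \<noteq> b j"
  shows "b l div 5 \<noteq> a 0 div 5"
proof
  assume closed: "b l div 5 = a 0 div 5"
  obtain s0 q0 i0 where v: "valid s0 q0 i0" "a 0 div 5 = half s0 q0 i0"
    using oriented_edge e by (metis le0)
  have "\<exists>s q i L. reached q0 i0 (Suc j) (b j) s q i L" if "j \<le> l" for j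
    using that
  proof (induction j)
    case 0
    then show ?case using reached_start[OF _ v] e by simp
  next
    case (Suc j)
    then obtain s q i L where "reached q0 i0 (Suc j) (b j) s q i L" by auto
    from reached_step[OF this, of "a (Suc j)" "b (Suc j)"] show ?case using e w Suc.prems by simp
  qed
  then obtain s q i L where R: "reached q0 i0 (Suc l) (b l) s q i L" by blast
  then have "s = s0 \<and> q = q0 \<and> i = i0"
    using half_inj closed v by (metis reached_def)
  then have "L \<noteq> []" "foldr \<pi> L q0 = q0" "length L \<le> r" "distinct_adj L" "set L \<subseteq> {..<m}"
    using R l by (auto simp: reached_def)
  then show False using no_relation v(1) by (auto simp: valid_def)
qed

text \<open>Residues mod 10 separate joins from bonds; within each kind the coordinates of an end
  determine the edge.\<close>

lemma edges_disjoint: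
  assumes "e \<in> joins \<union> bonds (m * Q)" "e' \<in> joins \<union> bonds (m * Q)" "v \<in> e" "v \<in> e'"
  shows "e = e'"
proof -
  have J: "(v = outp s q i \<or> v = inp s q (Suc i)) \<and> v mod 10 \<in> {1, 2, 7, 8}"
    if "v \<in> {outp s q i, inp s q (Suc i)}" "valid s q (Suc i)" for s q i
  proof -
    have "s = 0 \<or> s = 1" using that by (auto simp: valid_def)
    then show ?thesis using that(1) port_mod[of s] by (elim disjE) auto
  qed
  have B: "v mod 10 \<in> {4, 5} \<and> v div 10 = g" if "v \<in> bond g" for g
    using that by (auto simp: bond_def)
  show ?thesis
    using assms(1,2)
  proof (elim UnE)
    assume "e \<in> joins" "e' \<in> joins"
    then obtain s q i s' q' i' where v: "valid s q (Suc i)" "valid s' q' (Suc i')"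
      and e: "e = {outp s q i, inp s q (Suc i)}" "e' = {outp s' q' i', inp s' q' (Suc i')}"
      by (auto simp: joins_def)
    have v': "valid s q i" "valid s' q' i'" using v by (auto simp: valid_def)
    have "s = s' \<and> q = q' \<and> i = i'"
      using assms(3,4) e outp_inj[OF _ v'] inp_inj[OF _ v] outp_neq_inp[OF v'(1) v(2)] outp_neq_inp[OF v'(2) v(1)]
      by auto
    then show ?thesis using e by simp
  next
    assume "e \<in> bonds (m * Q)" "e' \<in> bonds (m * Q)"
    then show ?thesis using B assms(3,4) by (auto simp: bonds_def)
  next
    assume "e \<in> joins" "e' \<in> bonds (m * Q)"
    then have "v mod 10 \<in> {1, 2, 7, 8}" "v mod 10 \<in> {4, 5}" using J B assms(3,4) by (auto simp: bonds_def joins_def)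
    then show ?thesis by auto
  next
    assume "e \<in> bonds (m * Q)" "e' \<in> joins"
    then have "v mod 10 \<in> {1, 2, 7, 8}" "v mod 10 \<in> {4, 5}" using J B assms(3,4) by (auto simp: bonds_def joins_def)
    then show ?thesis by auto
  qed
qed

text \<open>The factor 2 appears because \<open>k\<close> edges have up to \<open>2*k\<close> ends,
  which bounds the length of the closed walk to be excluded.\<close>

lemma gadgets_joins:
  assumes "2 * k \<le> r" shows "gadgets (m * Q) k joins"
proof
  show "m * Q > 0" using m_pos Q_pos by simp
next
  fix e assume "e \<in> joins"
  then obtain s q i where v: "valid s q (Suc i)" and e: "e = {outp s q i, inp s q (Suc i)}"
    by (auto simp: joins_def)
  have v': "valid s q i" "s < 2" using v by (auto simp: valid_def)
  have "half s q i \<noteq> half s q (Suc i)" using half_inj[OF _ v'(1) v] by auto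
  then show "\<exists>u v. e = {u, v} \<and> u div 5 \<noteq> v div 5 \<and> u < 10*(m*Q) \<and> v < 10*(m*Q) \<and>
          u mod 10 \<in> {1, 2, 7, 8} \<and> v mod 10 \<in> {1, 2, 7, 8}"
    using port_div[OF v'(2)] port_less[OF v'(1)] port_less[OF v] port_mod[OF v'(2)]
    by (intro exI[of _ "outp s q i"] exI[of _ "inp s q (Suc i)"]) (auto simp: e)
next
  fix F assume F: "F \<subseteq> joins \<union> bonds (m * Q)" "F \<noteq> {}" "card F \<le> k"
  have two: "card e = 2" if "e \<in> joins \<union> bonds (m * Q)" for e
    using that
  proof
    assume "e \<in> joins"
    then obtain s q i where v: "valid s q (Suc i)" and e: "e = {outp s q i, inp s q (Suc i)}"
      by (auto simp: joins_def)
    then have "outp s q i \<noteq> inp s q (Suc i)" by (intro outp_neq_inp) (auto simp: valid_def)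
    then show ?thesis by (simp add: e)
  qed (auto simp: bonds_def bond_def)
  have "e \<subseteq> {..<10*(m*Q)}" if "e \<in> joins \<union> bonds (m * Q)" for e
    using that port_less by (auto simp: joins_def bonds_def bond_def valid_def)
  then have "F \<subseteq> Pow {..<10*(m*Q)}" using F(1) by blast
  then have fin: "finite F" by (rule finite_subset) simp
  show "card F < card ((\<lambda>v. v div 5) ` \<Union>F)"
  proof (rule card_less_nodes_if_no_closed_walk[OF fin F(2,3)])
    show "card e = 2" if "e \<in> F" for e using that F(1) two by blast
    show "e = e'" if "e \<in> F" "e' \<in> F" "e \<inter> e' \<noteq> {}" for e e'
      using that F(1) edges_disjoint[of e e'] by blast
    show "b l div 5 \<noteq> a 0 div 5" if "l < 2 * k" "\<forall>j\<le>l. {a j, b j} \<in> F"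
      "\<forall>j<l. a (Suc j) div 5 = b j div 5 \<and> a (Suc j) \<noteq> b j" for a b l
      using that assms F(1) by (intro no_closed_walk) auto
  qed
qed

subsection \<open>An almost optimal tour\<close>

text \<open>Halves are visited row by row; inside a half the tour runs from \<open>inp\<close> backwards around the
  5-cycle to \<open>outp\<close>.\<close>

definition hseq :: "nat \<Rightarrow> nat" where
  "hseq u = half (u div m div Q) (u div m mod Q) (u mod m)"

text \<open>The 6 is the offset 1 of \<open>inp\<close> raised by 5, so that the subtraction never
  truncates: the offset starts at \<open>1 + s\<close> and ends at \<open>2 + s\<close>.\<close>

definition tour :: "nat \<Rightarrow> nat" where
  "tour t = 5 * hseq (t div 5) + (t div 5 div m div Q + 6 - t mod 5) mod 5"

lemma hseq_valid: "u < 2 * (m * Q) \<Longrightarrow> valid (u div m div Q) (u div m mod Q) (u mod m)"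
proof -
  assume "u < 2 * (m * Q)"
  then have "u div (m * Q) < 2" using m_pos Q_pos by (simp add: less_mult_imp_div_less)
  then show ?thesis using m_pos Q_pos by (simp add: valid_def div_mult2_eq)
qed

lemma hseq_inj:
  assumes "hseq u = hseq u'" "u < 2 * (m * Q)" "u' < 2 * (m * Q)"
  shows "u = u'"
proof -
  have *: "u div m div Q = u' div m div Q" "u div m mod Q = u' div m mod Q" "u mod m = u' mod m"
    using half_inj[OF _ hseq_valid[OF assms(2)] hseq_valid[OF assms(3)]] assms(1) by (auto simp: hseq_def)
  then have "u div m = u' div m" by (metis div_mult_mod_eq)
  then show ?thesis using *(3) by (metis div_mult_mod_eq)
qed

lemma tour_div: "tour t div 5 = hseq (t div 5)"
  by (simp add: tour_def)

lemma tour_bij: "bij_betw tour {..<10 * (m * Q)} {..<10 * (m * Q)}"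
proof -
  have inj: "inj_on tour {..<10 * (m * Q)}"
  proof (rule inj_onI)
    fix t t' assume t: "t \<in> {..<10 * (m * Q)}" "t' \<in> {..<10 * (m * Q)}" and eq: "tour t = tour t'"
    have "t div 5 < 2 * (m * Q)" "t' div 5 < 2 * (m * Q)" using t by auto
    then have d: "t div 5 = t' div 5" using hseq_inj eq tour_div by metis
    define s where "s = t div 5 div m div Q"
    have s: "s < 2" using hseq_valid[of "t div 5"] t by (auto simp: valid_def s_def)
    have m5: "(s + 6 - t mod 5) mod 5 = (s + 6 - t' mod 5) mod 5"
      using eq d by (simp add: tour_def s_def)
    have eq_of_mod: "a = b" if "a mod 5 = b mod 5" "a < b + 5" "b < a + 5" for a b :: nat
      using that div_mult_mod_eq[of a 5] div_mult_mod_eq[of b 5]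
      by (cases "a div 5" "b div 5" rule: linorder_cases) linarith+
    have lt: "t mod 5 < 5" "t' mod 5 < 5" by auto
    \<comment> \<open>Both numbers lie in a window of length 5, so congruence mod 5 makes them
      equal.\<close>
    have "s + 6 - t mod 5 = s + 6 - t' mod 5" using m5 by (rule eq_of_mod) (use lt in linarith)+
    then have "t mod 5 = t' mod 5" using lt by linarith
    then show "t = t'" using d by (metis div_mult_mod_eq)
  qed
  have "tour t < 10 * (m * Q)" if "t < 10 * (m * Q)" for t
  proof -
    have "t div 5 < 2 * (m * Q)" using that by auto
    then have "tour t div 5 < 2 * (m * Q)"
      unfolding tour_div hseq_def by (intro half_less hseq_valid)
    then show ?thesis by linarith
  qed
  then have "tour ` {..<10 * (m * Q)} = {..<10 * (m * Q)}"
    using inj by (intro endo_inj_surj) auto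
  then show ?thesis using inj by (simp add: bij_betw_def)
qed

text \<open>Inside a half the tour follows the 5-cycle, and from one column to the next it uses a
  join. Only steps leaving the last column of a row can be expensive, and \<open>good\<close>
  excludes these.\<close>

lemma tour_cheap:
  assumes t: "t < 10 * (m * Q)" and good: "t mod (5 * m) \<noteq> 5 * m - 1"
  shows "{tour t, tour ((t + 1) mod (10 * (m * Q)))} \<in> cheap (m * Q) joins"
proof -
  define u j where "u = t div 5" and "j = t mod 5"
  define s q i where "s = u div m div Q" and "q = u div m mod Q" and "i = u mod m"
  have u: "u < 2 * (m * Q)" using t by (auto simp: u_def)
  have v: "valid s q i" using hseq_valid[OF u] by (simp add: s_def q_def i_def)
  then have s: "s < 2" by (simp add: valid_def)
  have h: "half s q i < 2 * (m * Q)" using half_less[OF v] .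
  have t_eq: "t = 5 * u + j" "j < 5" by (auto simp: u_def j_def)
  have tour_t: "tour t = 5 * half s q i + (s + 6 - j) mod 5"
    by (simp add: tour_def hseq_def u_def[symmetric] j_def[symmetric] s_def q_def i_def)
  show ?thesis
  proof (cases "j = 4")
    case False
    then have j: "j < 4" using t_eq by simp
    have "t + 1 < 10 * (m * Q)" using u j t_eq by linarith
    then have "(t + 1) mod (10 * (m * Q)) = t + 1" by simp
    moreover have "(t + 1) div 5 = u" "(t + 1) mod 5 = j + 1" using t_eq j by auto
    then have "tour (t + 1) = 5 * half s q i + (s + 6 - (j + 1)) mod 5"
      unfolding tour_def hseq_def by (simp add: s_def q_def i_def)
    moreover have "{5 * half s q i + (s + 6 - j) mod 5, 5 * half s q i + (s + 6 - (j + 1)) mod 5}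
        \<in> half_cycle (half s q i)"
    proof -
      have "s = 0 \<or> s = 1" "j = 0 \<or> j = 1 \<or> j = 2 \<or> j = 3" using s j by linarith+
      then show ?thesis by (elim disjE) (simp_all add: half_cycle_def insert_commute)
    qed
    ultimately show ?thesis using h tour_t by (auto simp: cheap_def)
  next
    case True
    have i: "i + 1 < m"
    proof (rule ccontr)
      assume "\<not> i + 1 < m"
      then have "i = m - 1" using v by (auto simp: valid_def)
      have "t mod (5 * m) = 5 * (u mod m) + j"
        using mod_mult2_eq[of t 5 m] by (simp add: u_def j_def)
      then show False using good \<open>i = m - 1\<close> True m_pos by (simp add: i_def algebra_simps)
    qed
    have u1: "(u + 1) div m = u div m" "(u + 1) mod m = i + 1"
      using i by (auto simp: i_def div_Suc mod_Suc)
    \<comment> \<open>A wrap-around would make \<open>u + 1\<close> a multiple of \<open>m\<close>,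
      but its column is \<open>i + 1\<close>, which is not 0.\<close>
    have "u + 1 < 2 * (m * Q)"
    proof (rule ccontr)
      assume "\<not> u + 1 < 2 * (m * Q)"
      then have "u + 1 = m * (2 * Q)" using u by simp
      then have "(u + 1) mod m = 0" by simp
      then show False using u1 by simp
    qed
    then have "t + 1 < 10 * (m * Q)" using t_eq True by linarith
    then have next_eq: "(t + 1) mod (10 * (m * Q)) = t + 1" by simp
    have t1: "t + 1 = 5 * (u + 1)" using t_eq True by simp
    have "tour (t + 1) = 5 * half s q (i + 1) + (s + 6) mod 5"
      unfolding t1 tour_def hseq_def using u1 by (simp add: s_def q_def)
    moreover have "(s + 6) mod 5 = 1 + s" "(s + 6 - j) mod 5 = 2 + s"
      using s True less_2_cases[of s] by auto
    ultimately have "tour (t + 1) = inp s q (Suc i)" "tour t = outp s q i"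
      using tour_t by (simp_all add: inp_def outp_def)
    moreover have "valid s q (Suc i)" using v i by (simp add: valid_def)
    ultimately have "{tour t, tour (t + 1)} \<in> joins" by (auto simp: joins_def)
    then show ?thesis unfolding next_eq cheap_def by blast
  qed
qed

text \<open>The two sides have \<open>Q\<close> rows each, and each row end contributes at most one
  expensive step.\<close>

lemma OPT_cover:
  assumes "c = gadgets.cost (m * Q) joins" "gadgets (m * Q) k joins"
  shows "OPT (10 * (m * Q)) c \<le> 10 * (m * Q) + 2 * Q"
proof -
  interpret gadgets "m * Q" k joins by fact
  let ?n = "10 * (m * Q)"
  have c: "c = cost" using assms(1) by simp
  have "{t \<in> {..<?n}. c {tour t, tour ((t + 1) mod ?n)} \<noteq> 1} \<subseteq> (\<lambda>u. 5 * m * u + (5 * m - 1)) ` {..<2 * Q}"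
  proof
    fix t assume "t \<in> {t \<in> {..<?n}. c {tour t, tour ((t + 1) mod ?n)} \<noteq> 1}"
    then have t: "t < ?n" "t mod (5 * m) = 5 * m - 1"
      using tour_cheap[of t] by (auto simp: c cost_def split: if_splits)
    have "t < 2 * Q * (5 * m)" using t(1) by (simp add: algebra_simps)
    then have "t div (5 * m) < 2 * Q" by (rule less_mult_imp_div_less)
    moreover have "t = 5 * m * (t div (5 * m)) + (5 * m - 1)" using t(2) mult_div_mod_eq[of "5 * m" t] by simp
    ultimately show "t \<in> (\<lambda>u. 5 * m * u + (5 * m - 1)) ` {..<2 * Q}" by blast
  qed
  then have "card {t \<in> {..<?n}. c {tour t, tour ((t + 1) mod ?n)} \<noteq> 1} \<le> card ((\<lambda>u. 5 * m * u + (5 * m - 1)) ` {..<2 * Q})"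
    by (intro card_mono) auto
  also have "\<dots> \<le> 2 * Q" using card_image_le[of "{..<2 * Q}"] by (metis card_lessThan finite_lessThan)
  finally have bad: "card {t \<in> {..<?n}. c {tour t, tour ((t + 1) mod ?n)} \<noteq> 1} \<le> 2 * Q" .
  have "m * Q > 0" using m_pos Q_pos by simp
  then have "?n \<ge> 3" by linarith
  moreover have "c e \<le> 2" for e by (simp add: c cost_def)
  ultimately have "OPT ?n c \<le> ?n + card {t \<in> {..<?n}. c {tour t, tour ((t + 1) mod ?n)} \<noteq> 1}"
    using OPT_reindex_le tour_bij by blast
  then show ?thesis using bad by linarith
qed

end

theorem theorem8p4:
  fixes k :: nat and \<epsilon> :: real
  assumes "k \<ge> 2" and "\<epsilon> > 0"
  shows "\<exists>n c T. is_12_instance n c \<and> is_tour n T \<and>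
           (\<forall>T'. kimprov_output k n c T T' \<longrightarrow>
                 real (tour_cost c T') \<ge> (11/10 - \<epsilon>) * real (OPT n c))"
proof -
  \<comment> \<open>Rows of length \<open>m\<close> make the \<open>2*Q\<close> expensive steps
    negligible against \<open>10*m*Q\<close>.\<close>
  obtain m :: nat where m: "1 / \<epsilon> < real m" using reals_Archimedean2 by blast
  then have m_pos: "m > 0" using assms(2) by (cases m) (auto simp: divide_less_0_iff)
  obtain Q \<pi> where "cover m Q (2 * k) \<pi>" using ex_cover[OF m_pos] .
  then interpret cover m Q "2 * k" \<pi> .
  interpret gadgets "m * Q" k joins using gadgets_joins by simp
  let ?n = "10 * (m * Q)"
  obtain T where T: "is_tour ?n T"
    "\<And>T'. kimprov_output k ?n cost T T' \<Longrightarrow> 11 * (m * Q) \<le> tour_cost cost T'"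
    using locally_optimal_tour[of k] by auto
  have opt: "OPT ?n cost \<le> ?n + 2 * Q" using OPT_cover gadgets_joins by blast
  \<comment> \<open>For large \<open>\<epsilon>\<close> the factor is not positive, so multiplying
    the upper bound on the optimum by it is not monotone; that case is trivial.\<close>
  have bound: "(11/10 - \<epsilon>) * real (OPT ?n cost) \<le> real (11 * (m * Q))"
  proof (cases "11/10 - \<epsilon> \<le> 0")
    case True
    then have "(11/10 - \<epsilon>) * real (OPT ?n cost) \<le> 0" by (simp add: mult_nonpos_nonneg)
    then show ?thesis by (meson of_nat_0_le_iff order_trans)
  next
    case False
    \<comment> \<open>What remains is 11/5 * Q \<le> 10 * \<epsilon> * m * Q + 2 * \<epsilon> * Q,
      which follows from this.\<close>
    have "1 < \<epsilon> * real m" using m assms(2) by (simp add: field_simps)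
    then have "real Q * 1 \<le> real Q * (\<epsilon> * real m)" by (intro mult_left_mono) auto
    moreover have "0 \<le> \<epsilon> * real Q" using assms(2) by simp
    moreover have "real (OPT ?n cost) \<le> real (?n + 2 * Q)" using opt of_nat_mono by blast
    then have "(11/10 - \<epsilon>) * real (OPT ?n cost) \<le> (11/10 - \<epsilon>) * real (?n + 2 * Q)"
      using False by (intro mult_left_mono) auto
    ultimately show ?thesis by (simp add: algebra_simps)
  qed
  have "is_12_instance ?n cost" by (simp add: is_12_instance_def cost_def)
  moreover have "(11/10 - \<epsilon>) * real (OPT ?n cost) \<le> real (tour_cost cost T')"
    if "kimprov_output k ?n cost T T'" for T'
    using bound T(2)[OF that] of_nat_mono order_trans by blast
  ultimately show ?thesis using T(1) by blast
qed

end
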